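(* As $n\to\infty$, the distributions of $X_n$ and $Y_n$ are concentrated around their mean, i.e. $$\frac{X_n}{\mathrm{E}(X_n)}\longrightarrow1\quad\text{and}\quad\frac{Y_n}{\mathrm{E}(Y_n)}\longrightarrow1\quad\text{in probability}.$$
   Context: $\Pi_n$ is the set of all partitions of $[n]=\{1,\dots,n\}$. For $\pi\in\Pi_n$: the arcs of its linear representation are the pairs $(i,j)$, $i<j$, where $i,j$ are consecutive elements (in increasing order) of the same block. $\mathrm{cr}^{(\ell)}(\pi)$ is the number of (unordered) pairs of crossing arcs, i.e. pairs of arcs $(i,j),(i',j')$ with $i<i'<j<j'$. The chords of its circular representation are obtained by placing $1,\dots,n$ in order on a circle and drawing each block as the convex polygon on its elements: a block $\{b_1<\dots<b_m\}$ contributes no chord if $m=1$, the single chord $\{b_1,b_2\}$ if $m=2$, and the $m$ chords $\{b_1,b_2\},\dots,\{b_{m-1},b_m\},\{b_1,b_m\}$ if $m\ge3$. $\mathrm{cr}^{(c)}(\pi)$ is the number of (unordered) pairs of crossing chords, i.e. pairs of chords $\{i,j\},\{i',j'\}$ with $i<i'<j<j'$. $X_n$ and $Y_n$ are the random variables equal to $\mathrm{cr}^{(\ell)}(\pi)$ and $\mathrm{cr}^{(c)}(\pi)$, respectively, for $\pi$ uniformly distributed on $\Pi_n$ (their means are positive for $n$ large). *)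

theory Defs
  imports "HOL-Probability.Probability"
begin

definition set_partitions :: "nat \<Rightarrow> nat set set set" where
  "set_partitions n = {P. partition_on {1..n} P}"

lemma finite_set_partitions [simp]: "finite (set_partitions n)"
  unfolding set_partitions_def by (rule finitely_many_partition_on) simp

lemma set_partitions_nonempty [simp]: "set_partitions n \<noteq> {}"
proof -
  have "partition_on {1..n} ((\<lambda>i. {i}) ` {1..n})"
    by (auto simp: partition_on_def disjoint_def)
  then show ?thesis
    unfolding set_partitions_def by blast
qed

text \<open>
  Arcs and chords are encoded as pairs \<open>(i, j)\<close> with \<open>i < j\<close>, so that each of them is
  counted once.
\<close>

definition block_arcs :: "nat set \<Rightarrow> (nat \<times> nat) set" where
  "block_arcs B = {(i, j). i \<in> B \<and> j \<in> B \<and> i < j \<and> \<not> (\<exists>k\<in>B. i < k \<and> k < j)}"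

definition arcs :: "nat set set \<Rightarrow> (nat \<times> nat) set" where
  "arcs P = (\<Union>B\<in>P. block_arcs B)"

text \<open>
  The sides of the convex polygon on a block are the arcs of the block together with the
  closing side from its least to its greatest element. For a block of size two the
  polygon degenerates to a single chord, which already is an arc.
\<close>

definition block_chords :: "nat set \<Rightarrow> (nat \<times> nat) set" where
  "block_chords B = block_arcs B \<union> (if card B \<ge> 3 then {(Min B, Max B)} else {})"

definition chords :: "nat set set \<Rightarrow> (nat \<times> nat) set" where
  "chords P = (\<Union>B\<in>P. block_chords B)"

text \<open>
  The condition \<open>i < i' < j < j'\<close> holds for at most one ordering of two given arcs or
  chords, so counting ordered pairs here counts each unordered crossing pair once.
\<close>

definition crossings :: "(nat \<times> nat) set \<Rightarrow> ((nat \<times> nat) \<times> (nat \<times> nat)) set" where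
  "crossings E = {((i, j), (i', j')). (i, j) \<in> E \<and> (i', j') \<in> E \<and> i < i' \<and> i' < j \<and> j < j'}"

definition cr_linear :: "nat set set \<Rightarrow> nat" where
  "cr_linear P = card (crossings (arcs P))"

definition cr_circular :: "nat set set \<Rightarrow> nat" where
  "cr_circular P = card (crossings (chords P))"

definition uniform_partition :: "nat \<Rightarrow> nat set set pmf" where
  "uniform_partition n = pmf_of_set (set_partitions n)"

definition X :: "nat \<Rightarrow> nat set set \<Rightarrow> real" where
  "X n = (\<lambda>P. real (cr_linear P))"

definition Y :: "nat \<Rightarrow> nat set set \<Rightarrow> real" where
  "Y n = (\<lambda>P. real (cr_circular P))"

text \<open>
  Convergence in probability to a constant; the \<open>n\<close>-th random variable may live on its
  own probability space \<open>M n\<close>.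
\<close>

definition converges_in_prob ::
    "(nat \<Rightarrow> 'a measure) \<Rightarrow> (nat \<Rightarrow> 'a \<Rightarrow> real) \<Rightarrow> real \<Rightarrow> bool" where
  "converges_in_prob M Z c \<longleftrightarrow>
     (\<forall>\<epsilon>>0. (\<lambda>n. measure (M n) {\<omega> \<in> space (M n). \<bar>Z n \<omega> - c\<bar> > \<epsilon>}) \<longlonglongrightarrow> 0)"

end

theory Submission
  imports Defs
begin

text \<open>
  The idea is that both crossing numbers of a partition \<open>P\<close> of \<open>n\<close> points are close to
  \<open>n * card P / 2\<close>, and that the number of blocks of a random partition is concentrated.
  
  A linear crossing \<open>i < i' < j < j'\<close> is determined by its middle ends \<open>i'\<close> and \<open>j\<close>. These lie in
  different blocks \<open>B\<close> and \<open>C\<close> and are neighbours in \<open>B \<union> C\<close>. Conversely, such an alternating pair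
  of neighbours comes from a crossing unless it involves the last point of \<open>B\<close> or the first point
  of \<open>C\<close>, and there are at most \<open>2 (card P)\<^sup>2\<close> exceptions
  (\<open>cr_linear_le_alternations\<close>, \<open>alternations_le_cr_linear\<close>). The closing sides of the polygons
  add at most \<open>4 (card P)\<^sup>2\<close> further crossings (\<open>cr_circular_le\<close>). As a random partition has
  \<open>o(n)\<close> blocks, such errors are negligible against \<open>n * card P\<close>, so linear and circular crossings
  can be treated together.
  
  For two blocks, the pairs of neighbours in \<open>B \<union> C\<close> number \<open>card B + card C - 1\<close>, and about half of
  them should alternate, because a random splitting of \<open>B \<union> C\<close> into two parts separates each pair
  with probability one half. The deviation from one half, summed over all pairs of blocks, is up to
  a constant factor the total balance (\<open>card_alternations\<close>). Its second moment is small: the bijection between partitions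
  with two marked blocks and partitions with one marked and split block
  (\<open>sum_partitions_merge\<close>) makes the contributions of disjoint pairs of blocks cancel almost
  completely, and the remaining ones are few (\<open>sum_total_balance_square\<close>).
  
  The mean of \<open>card P + 1\<close> is the ratio \<open>r\<^sub>n\<close> of consecutive Bell numbers. Three facts about these
  ratios suffice: \<open>r\<^sub>n\<close> tends to infinity (\<open>bell_ratio_at_top\<close>), \<open>r\<^sub>n / n\<close> tends to zero
  (\<open>bell_ratio_sublinear\<close>), and \<open>r\<close> increases by at most one in each step
  (\<open>bell_ratio_Suc_le\<close>), which bounds the variance of \<open>card P\<close> by \<open>r\<^sub>n\<close>. Altogether the mean
  distance of either crossing number from \<open>n r\<^sub>n / 2\<close> is \<open>o(n r\<^sub>n)\<close>
  (\<open>crossings_mean_deviation\<close>), and Markov's inequality gives the concentration.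
\<close>

section \<open>Partitions and insertion of one point\<close>

abbreviation partitions_of :: "'a set \<Rightarrow> 'a set set set" where
  "partitions_of A \<equiv> {P. partition_on A P}"

lemma same_block: "partition_on A P \<Longrightarrow> B \<in> P \<Longrightarrow> C \<in> P \<Longrightarrow> x \<in> B \<Longrightarrow> x \<in> C \<Longrightarrow> B = C"
  by (auto simp: partition_on_def disjoint_def)

lemma disjnt_other_blocks: "partition_on A P \<Longrightarrow> U \<in> P \<Longrightarrow> disjnt U (\<Union>(P - {U}))"
  by (auto simp: disjnt_def dest: same_block)

lemma partition_on_remove_block:
  "partition_on A P \<Longrightarrow> U \<in> P \<Longrightarrow> partition_on (A - U) (P - {U}) \<and> U \<subseteq> A \<and> U \<noteq> {}"
  using partition_on_insert[OF disjnt_other_blocks, of A P U A] by (simp add: insert_absorb)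

text \<open>
  The new point \<open>a\<close> either forms a block of its own or joins a block \<open>B\<close> of a partition of the
  remaining points. Summed over all partitions, this is the recursion behind every count by
  number of blocks below.
\<close>

lemma sum_partitions_insert:
  fixes F :: "'a set set \<Rightarrow> 'b::comm_monoid_add"
  assumes fin: "finite A" and a: "a \<notin> A"
  shows "(\<Sum>P\<in>partitions_of (insert a A). F P) =
         (\<Sum>P\<in>partitions_of A. F (insert {a} P) + (\<Sum>B\<in>P. F (insert (insert a B) (P - {B}))))"
proof -
  let ?S = "partitions_of (insert a A)"
  have finS: "finite ?S" using fin by (intro finitely_many_partition_on) auto
  have finP: "finite P" if "partition_on A P" for P
    using that fin finite_elements by blast
  have aP: "a \<notin> \<Union>P" if "partition_on A P" for P
    using that a by (auto simp: partition_on_def)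
  have "(\<Sum>P\<in>?S. F P) = (\<Sum>P\<in>{P\<in>?S. {a} \<in> P}. F P) + (\<Sum>P\<in>{P\<in>?S. {a} \<notin> P}. F P)"
    by (subst sum.union_disjoint[symmetric]) (auto intro!: sum.cong finite_subset[OF _ finS])
  also have "(\<Sum>P\<in>{P\<in>?S. {a} \<in> P}. F P) = (\<Sum>P\<in>partitions_of A. F (insert {a} P))"
  proof (rule sum.reindex_bij_witness[of _ "insert {a}" "\<lambda>P. P - {{a}}"])
    fix P assume "P \<in> {P\<in>?S. {a} \<in> P}"
    then have P: "partition_on (insert a A) P" "{a} \<in> P" by auto
    then show "P - {{a}} \<in> partitions_of A"
      using partition_on_remove_block[of "insert a A" P "{a}"] a by simp
  next
    fix P assume "P \<in> partitions_of A"
    with a aP[of P] show "insert {a} P \<in> {P\<in>?S. {a} \<in> P}"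
      by (auto simp: partition_on_insert)
  qed (use aP in \<open>auto simp: insert_absorb\<close>)
  also have "(\<Sum>P\<in>{P\<in>?S. {a} \<notin> P}. F P)
      = (\<Sum>(P, B)\<in>Sigma (partitions_of A) (\<lambda>P. P). F (insert (insert a B) (P - {B})))"
  \<comment> \<open>The inverse map deletes \<open>a\<close> from its block; the union in it picks out that block.\<close>
  proof (rule sum.reindex_bij_witness[of _ "\<lambda>(P, B). insert (insert a B) (P - {B})"
        "\<lambda>P. let U = \<Union>{B\<in>P. a \<in> B} in (insert (U - {a}) (P - {U}), U - {a})"])
    fix P assume "P \<in> {P\<in>?S. {a} \<notin> P}"
    then have P: "partition_on (insert a A) P" "{a} \<notin> P" by auto
    then obtain U where U: "U \<in> P" "a \<in> U" by (auto simp: partition_on_def)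
    have "{B\<in>P. a \<in> B} = {U}" using P U by (auto dest: same_block)
    then have eq: "\<Union>{B\<in>P. a \<in> B} = U" by simp
    have aU: "insert a (U - {a}) = U" using U by auto
    then have ne: "U - {a} \<noteq> {}" using U P by metis
    have notin: "U - {a} \<notin> P - {U}"
    proof
      assume "U - {a} \<in> P - {U}"
      moreover obtain x where "x \<in> U - {a}" using ne by auto
      ultimately show False using same_block[OF P(1), of "U - {a}" U x] U by auto
    qed
    have "disjnt U (\<Union>(P - {U}))" using disjnt_other_blocks P U by auto
    then have **: "disjnt (U - {a}) (\<Union>(P - {U}))" by (auto simp: disjnt_def)
    have "partition_on (insert a A - U) (P - {U})" "U \<subseteq> insert a A"
      using partition_on_remove_block[OF P(1) U(1)] by blast+
    moreover have "insert a A - U = A - (U - {a})" using U a by auto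
    ultimately have new: "partition_on A (insert (U - {a}) (P - {U}))"
      using partition_on_insert[OF **, of A] ne by auto
    from new show "(let U = \<Union>{B\<in>P. a \<in> B} in (insert (U - {a}) (P - {U}), U - {a}))
        \<in> Sigma (partitions_of A) (\<lambda>P. P)"
      unfolding eq by (simp add: Let_def)
    show "(\<lambda>(P, B). insert (insert a B) (P - {B}))
        (let U = \<Union>{B\<in>P. a \<in> B} in (insert (U - {a}) (P - {U}), U - {a})) = P"
      unfolding eq using U notin aU by (auto simp: Let_def)
    then show "(case let U = \<Union>{B\<in>P. a \<in> B} in (insert (U - {a}) (P - {U}), U - {a}) of
          (P, B) \<Rightarrow> F (insert (insert a B) (P - {B}))) = F P"
      by (simp add: Let_def case_prod_beta)
  next
    fix PB assume "PB \<in> Sigma (partitions_of A) (\<lambda>P. P)"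
    then obtain P B where PB: "PB = (P, B)" "partition_on A P" "B \<in> P" by auto
    have aB: "a \<notin> B" and aP': "\<And>C. C \<in> P \<Longrightarrow> a \<notin> C" using aP PB by auto
    have "{C\<in>insert (insert a B) (P - {B}). a \<in> C} = {insert a B}" using aP' by auto
    then have eq: "\<Union>{C\<in>insert (insert a B) (P - {B}). a \<in> C} = insert a B" by simp
    have dj': "disjnt (insert a B) (\<Union>(P - {B}))"
      using aP' disjnt_other_blocks[of A P B] PB by (auto simp: disjnt_def)
    have "partition_on (A - B) (P - {B})" "B \<subseteq> A" "B \<noteq> {}"
      using partition_on_remove_block[OF PB(2,3)] by blast+
    moreover have "insert a A - insert a B = A - B" using a by auto
    ultimately have "partition_on (insert a A) (insert (insert a B) (P - {B}))"
      by (subst partition_on_insert[OF dj']) auto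
    moreover have "{a} \<noteq> insert a B" using aB \<open>B \<noteq> {}\<close> by auto
    ultimately show "(case PB of (P, B) \<Rightarrow> insert (insert a B) (P - {B})) \<in> {P\<in>?S. {a} \<notin> P}"
      using PB aP' by auto
    have "insert a B - {a} = B" using aB by auto
    moreover have "insert a B \<notin> P" using aP' by auto
    ultimately show "(let U = \<Union>{C\<in>case PB of (P, B) \<Rightarrow> insert (insert a B) (P - {B}). a \<in> C} in
        (insert (U - {a}) ((case PB of (P, B) \<Rightarrow> insert (insert a B) (P - {B})) - {U}), U - {a})) = PB"
      using PB eq by (auto simp: Let_def)
  qed
  also have "\<dots> = (\<Sum>P\<in>partitions_of A. \<Sum>B\<in>P. F (insert (insert a B) (P - {B})))"
    by (rule sum.Sigma[symmetric]) (use fin finP in \<open>auto intro: finitely_many_partition_on\<close>)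
  finally show ?thesis by (simp add: sum.distrib)
qed

section \<open>Bell numbers\<close>

text \<open>
  The sum of \<open>f (card P)\<close> over the partitions \<open>P\<close> of an \<open>n\<close>-element set, as a function of \<open>n\<close> alone.
  Inserting one point turns \<open>f\<close> into \<open>m \<mapsto> f (m + 1) + m f m\<close>, so all such sums are iterates of one
  linear operator evaluated at \<open>0\<close>.
\<close>

primrec sum_by_card :: "nat \<Rightarrow> (nat \<Rightarrow> real) \<Rightarrow> real" where
  "sum_by_card 0 f = f 0"
| "sum_by_card (Suc n) f = sum_by_card n (\<lambda>m. f (Suc m) + real m * f m)"

lemma sum_partitions_card:
  assumes "finite A"
  shows "(\<Sum>P\<in>partitions_of A. f (card P)) = sum_by_card (card A) f"
  using assms
proof (induction A arbitrary: f rule: finite_induct)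
  case empty
  then show ?case by (simp add: partition_on_empty)
next
  case (insert a A)
  have "f (card (insert {a} P)) + (\<Sum>B\<in>P. f (card (insert (insert a B) (P - {B}))))
      = f (Suc (card P)) + real (card P) * f (card P)" if "partition_on A P" for P
  proof -
    have P: "finite P" "a \<notin> \<Union>P"
      using that insert.hyps by (auto simp: partition_on_def intro: finite_UnionD)
    have "card (insert (insert a B) (P - {B})) = card P" if "B \<in> P" for B
    proof -
      have "insert a B \<notin> P - {B}" using P by blast
      then have "card (insert (insert a B) (P - {B})) = Suc (card (P - {B}))"
        using P by simp
      then show ?thesis using P that by (simp only: card_Suc_Diff1)
    qed
    then have "(\<Sum>B\<in>P. f (card (insert (insert a B) (P - {B})))) = (\<Sum>B\<in>P. f (card P))"
      by (intro sum.cong) simp_all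
    moreover have "{a} \<notin> P" using P by blast
    ultimately show ?thesis using P by simp
  qed
  then have "(\<Sum>P\<in>partitions_of (insert a A). f (card P))
      = (\<Sum>P\<in>partitions_of A. f (Suc (card P)) + real (card P) * f (card P))"
    unfolding sum_partitions_insert[OF insert.hyps] by (intro sum.cong) simp_all
  also have "\<dots> = sum_by_card (card A) (\<lambda>m. f (Suc m) + real m * f m)"
    by (rule insert.IH)
  finally show ?case using insert.hyps by simp
qed

lemma sum_set_partitions_card: "(\<Sum>P\<in>set_partitions n. f (card P)) = sum_by_card n f"
  unfolding set_partitions_def using sum_partitions_card[of "{1..n}" f] by simp

lemma sum_by_card_add: "sum_by_card n (\<lambda>m. f m + g m) = sum_by_card n f + sum_by_card n g"
  unfolding sum_set_partitions_card[symmetric] by (rule sum.distrib)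

definition bell :: "nat \<Rightarrow> real" where
  "bell n = real (card (set_partitions n))"

lemma bell_eq_sum_by_card: "bell n = sum_by_card n (\<lambda>_. 1)"
  unfolding sum_set_partitions_card[symmetric] by (simp add: bell_def)

lemma bell_pos: "bell n > 0"
  by (simp add: bell_def card_gt_0_iff)

lemma bell_Suc: "bell (Suc n) = (\<Sum>P\<in>set_partitions n. real (card P) + 1)"
  unfolding bell_eq_sum_by_card sum_set_partitions_card[where f="\<lambda>m. real m + 1"]
  by (simp add: add.commute)

text \<open>
  Up to the added \<open>1\<close>, the second moment of \<open>card P + 1\<close> is again a Bell number. With
  \<open>bell_Suc\<close>, mean and variance of the number of blocks are controlled by ratios of consecutive
  Bell numbers.
\<close>

lemma bell_Suc_Suc: "bell (Suc (Suc n)) = (\<Sum>P\<in>set_partitions n. (real (card P) + 1)^2 + 1)"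
proof -
  have "(\<lambda>m. real (Suc m) + 1 + real m * (real m + 1)) = (\<lambda>m. (real m + 1)^2 + 1)"
    by (auto simp: power2_eq_square algebra_simps)
  then show ?thesis
    unfolding bell_eq_sum_by_card sum_set_partitions_card[where f="\<lambda>m. (real m + 1)^2+1"]
    by (simp add: add.commute)
qed

text \<open>
  If \<open>T\<close> is the operator in \<open>sum_by_card\<close> and \<open>E\<close> the shift \<open>f \<mapsto> f \<circ> Suc\<close>, then \<open>E T = (T + 1) E\<close>.
  Hence \<open>E T\<^sup>n = (T + 1)\<^sup>n E\<close>, and evaluating at \<open>0\<close>, where \<open>T f\<close> equals \<open>E f\<close>, gives the
  binomial formula. The case \<open>f = 1\<close> is the classical recurrence of the Bell numbers.
\<close>

lemma sum_by_card_Suc_binomial: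
  "sum_by_card (Suc n) f = (\<Sum>j\<le>n. real (n choose j) * sum_by_card j (\<lambda>m. f (Suc m)))"
proof (induction n arbitrary: f)
  case 0
  then show ?case by simp
next
  case (Suc n)
  define a where "a j = sum_by_card j (\<lambda>m. f (Suc m))" for j
  have step: "sum_by_card j (\<lambda>m. f (Suc (Suc m)) + real (Suc m) * f (Suc m)) = a (Suc j) + a j" for j
  proof -
    have "(\<lambda>m. f (Suc (Suc m)) + real (Suc m) * f (Suc m))
        = (\<lambda>m. (f (Suc (Suc m)) + real m * f (Suc m)) + f (Suc m))"
      by (auto simp: algebra_simps)
    then show ?thesis by (simp only: sum_by_card_add a_def sum_by_card.simps)
  qed
  have "sum_by_card (Suc (Suc n)) f
      = sum_by_card (Suc n) (\<lambda>m. f (Suc m) + real m * f m)" by simp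
  also have "\<dots> = (\<Sum>j\<le>n. real (n choose j) * (a (Suc j) + a j))"
    by (subst Suc.IH) (simp only: step)
  also have "\<dots> = (\<Sum>j\<le>n. real (n choose j) * a (Suc j)) + (\<Sum>j\<le>Suc n. real (n choose j) * a j)"
    by (simp add: algebra_simps sum.distrib)
  also have "(\<Sum>j\<le>Suc n. real (n choose j) * a j)
      = a 0 + (\<Sum>j\<le>n. real (n choose Suc j) * a (Suc j))"
    by (subst sum.atMost_Suc_shift) simp
  also have "(\<Sum>j\<le>n. real (n choose j) * a (Suc j)) + (a 0 + (\<Sum>j\<le>n. real (n choose Suc j) * a (Suc j)))
      = a 0 + (\<Sum>j\<le>n. real (Suc n choose Suc j) * a (Suc j))"
    by (simp add: algebra_simps sum.distrib)
  also have "\<dots> = (\<Sum>j\<le>Suc n. real (Suc n choose j) * a j)"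
    by (subst sum.atMost_Suc_shift) simp
  finally show ?case by (simp only: a_def)
qed

lemma bell_binomial: "bell (Suc n) = (\<Sum>j\<le>n. real (n choose j) * bell j)"
  unfolding bell_eq_sum_by_card by (rule sum_by_card_Suc_binomial)

text \<open>
  This is the mean of \<open>card P + 1\<close> over the partitions of an \<open>n\<close>-element set.
\<close>

definition bell_ratio :: "nat \<Rightarrow> real" where
  "bell_ratio n = bell (Suc n) / bell n"

lemma bell_Suc_eq: "bell (Suc n) = bell_ratio n * bell n"
  using bell_pos[of n] by (simp add: bell_ratio_def)

lemma bell_ratio_ge_1: "bell_ratio n \<ge> 1"
proof -
  have "bell n = (\<Sum>P\<in>set_partitions n. 1)" by (simp add: bell_def)
  also have "\<dots> \<le> bell (Suc n)" unfolding bell_Suc by (intro sum_mono) auto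
  finally show ?thesis using bell_pos[of n] by (simp add: bell_ratio_def)
qed

text \<open>
  The Cauchy-Schwarz inequality: the second moment of \<open>card P + 1\<close> is at least the square of its
  mean. The summand \<open>1 / bell_ratio n\<close> comes from the excess \<open>1\<close> in \<open>bell_Suc_Suc\<close>; it
  already forces the ratios to grow at least like a square root.
\<close>

lemma bell_ratio_Suc_ge: "bell_ratio (Suc n) \<ge> bell_ratio n + 1 / bell_ratio n"
proof -
  let ?S = "set_partitions n"
  have "(\<Sum>P\<in>?S. real (card P) + 1)\<^sup>2 \<le> (\<Sum>P\<in>?S. (real (card P) + 1)\<^sup>2) * (\<Sum>P\<in>?S. 1\<^sup>2)"
    using Cauchy_Schwarz_ineq_sum[of "\<lambda>P. real (card P) + 1" "\<lambda>_. 1" ?S] by simp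
  also have "(\<Sum>P\<in>?S. (real (card P) + 1)\<^sup>2) = bell (Suc (Suc n)) - bell n"
    by (simp add: bell_Suc_Suc sum.distrib bell_def[of n])
  finally have "(bell (Suc n))\<^sup>2 \<le> (bell (Suc (Suc n)) - bell n) * bell n"
    by (simp add: bell_Suc bell_def[of n])
  then have "(bell_ratio n)\<^sup>2 * (bell n)\<^sup>2 \<le> (bell_ratio (Suc n) * bell_ratio n - 1) * (bell n)\<^sup>2"
    by (simp add: bell_Suc_eq power2_eq_square algebra_simps)
  then have "(bell_ratio n)\<^sup>2 \<le> bell_ratio (Suc n) * bell_ratio n - 1"
    using bell_pos[of n] by simp
  then show ?thesis
    using bell_ratio_ge_1[of n] by (simp add: field_simps power2_eq_square)
qed

lemma incseq_bell_ratio: "incseq bell_ratio"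
proof (rule incseq_SucI)
  fix n show "bell_ratio n \<le> bell_ratio (Suc n)"
    using bell_ratio_Suc_ge[of n] bell_ratio_ge_1[of n]
    by (smt (verit) divide_nonneg_pos)
qed

lemma bell_ratio_ge_sqrt: "sqrt (real n) \<le> bell_ratio n"
proof -
  have "real n \<le> (bell_ratio n)\<^sup>2"
  proof (induction n)
    case (Suc n)
    have "(bell_ratio n)\<^sup>2 + 1 \<le> (bell_ratio n + 1 / bell_ratio n)\<^sup>2"
      using bell_ratio_ge_1[of n] by (simp add: power2_sum)
    also have "\<dots> \<le> (bell_ratio (Suc n))\<^sup>2"
      using bell_ratio_Suc_ge[of n] bell_ratio_ge_1[of n] by (intro power_mono) auto
    finally show ?case using Suc by simp
  qed simp
  then show ?thesis
    using bell_ratio_ge_1[of n] real_le_lsqrt by force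
qed

lemma bell_ratio_at_top: "filterlim bell_ratio at_top sequentially"
proof (rule filterlim_at_top_mono)
  show "filterlim (\<lambda>n. sqrt (real n)) at_top sequentially"
    using filterlim_compose[OF sqrt_at_top filterlim_real_sequentially] .
qed (simp add: bell_ratio_ge_sqrt)

text \<open>
  This is what makes the number of blocks concentrated: its variance turns out to be at most
  \<open>bell_ratio n\<close>, far below the square of its mean. Writing \<open>r\<^sub>j\<close> for the ratios, the
  binomial formula gives
  \<open>bell (n + 2) = bell (n + 1) + (\<Sum>j\<le>n. (n choose j) r\<^sub>j bell j)\<close>, and \<open>r\<^sub>j \<le> r\<^sub>n\<close> there.
\<close>

lemma bell_ratio_Suc_le: "bell_ratio (Suc n) \<le> bell_ratio n + 1"
proof -
  have "bell (Suc (Suc n)) = bell (Suc n) + (\<Sum>j\<le>n. real (n choose j) * bell (Suc j))"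
  proof -
    have "bell (Suc (Suc n))
        = (\<Sum>j\<le>n. real (n choose j) * sum_by_card j (\<lambda>m. 1 + real (Suc m)))"
      unfolding bell_eq_sum_by_card
      by (subst sum_by_card.simps, subst sum_by_card_Suc_binomial) simp
    moreover have "sum_by_card j (\<lambda>m. 1 + real (Suc m)) = bell j + bell (Suc j)" for j
      unfolding sum_by_card_add bell_eq_sum_by_card by (simp add: add.commute)
    ultimately show ?thesis
      by (simp add: bell_binomial sum.distrib algebra_simps)
  qed
  also have "(\<Sum>j\<le>n. real (n choose j) * bell (Suc j))
      \<le> (\<Sum>j\<le>n. bell_ratio n * (real (n choose j) * bell j))"
  proof (rule sum_mono)
    fix j assume "j \<in> {..n}"
    then have "bell_ratio j \<le> bell_ratio n" using incseqD[OF incseq_bell_ratio] by simp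
    then have "bell_ratio j * bell j * real (n choose j) \<le> bell_ratio n * bell j * real (n choose j)"
      using bell_pos[of j] by (intro mult_right_mono) auto
    then show "real (n choose j) * bell (Suc j) \<le> bell_ratio n * (real (n choose j) * bell j)"
      by (simp add: bell_Suc_eq mult_ac)
  qed
  also have "\<dots> = bell_ratio n * bell (Suc n)"
    by (simp add: bell_binomial sum_distrib_left)
  finally show ?thesis
    using bell_pos[of "Suc n"] by (simp add: bell_ratio_def[of "Suc n"] field_simps)
qed

lemma bell_ratio_add_le: "bell_ratio (n + k) \<le> bell_ratio n + real k"
proof (induction k)
  case (Suc k)
  then show ?case using bell_ratio_Suc_le[of "n + k"] by simp
qed simp

lemma bell_add_ge: "bell m * bell_ratio m ^ j \<le> bell (m + j)"
proof (induction j)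
  case (Suc j)
  have "bell m * bell_ratio m ^ Suc j \<le> bell_ratio m * bell (m + j)"
    using Suc bell_ratio_ge_1[of m] mult_left_mono[OF Suc, of "bell_ratio m"] by (simp add: mult_ac)
  also have "\<dots> \<le> bell_ratio (m + j) * bell (m + j)"
    using bell_pos[of "m+j"] incseqD[OF incseq_bell_ratio, of m "m+j"] by (intro mult_right_mono) auto
  finally show ?case by (simp add: bell_Suc_eq)
qed simp

text \<open>
  In \<open>bell (n + 1) = (\<Sum>j\<le>n. (n choose j) bell (n - j))\<close> the terms with \<open>j > s\<close> contribute at
  most \<open>n bell n / s\<close>, because \<open>j (n choose j) = n (n - 1 choose j - 1)\<close> makes the sum weighted by
  \<open>j\<close> equal to \<open>n bell n\<close>. In each of the other terms \<open>bell (n - j)\<close> is compared with \<open>bell n\<close>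
  through the \<open>j\<close> ratios in between, all of which are at least \<open>bell_ratio (n - s)\<close>.
\<close>

lemma bell_ratio_le:
  assumes "0 < s" "s \<le> n"
  shows "bell_ratio n \<le> real n / real s + (\<Sum>j\<le>s. (real n / bell_ratio (n - s)) ^ j)"
proof -
  let ?t = "\<lambda>j. real (n choose j) * bell (n - j)"
  have "bell (Suc n) = (\<Sum>j\<le>n. ?t j)"
    unfolding bell_binomial
    by (rule sum.reindex_bij_witness[of _ "\<lambda>j. n - j" "\<lambda>j. n - j"])
       (auto simp: binomial_symmetric[symmetric])
  also have "\<dots> = (\<Sum>j\<le>s. ?t j) + (\<Sum>j\<in>{s<..n}. ?t j)"
    using assms by (subst sum.union_disjoint[symmetric]) (auto intro!: sum.cong)
  also have "(\<Sum>j\<in>{s<..n}. ?t j) \<le> real n / real s * bell n"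
  proof -
    have "real s * (\<Sum>j\<in>{s<..n}. ?t j) \<le> (\<Sum>j\<in>{s<..n}. real j * ?t j)"
      unfolding sum_distrib_left using bell_pos[THEN less_imp_le]
      by (intro sum_mono mult_right_mono) auto
    also have "\<dots> \<le> (\<Sum>j\<in>{1..n}. real j * ?t j)"
      using bell_pos[THEN less_imp_le] assms by (intro sum_mono2) auto
    also have "\<dots> = (\<Sum>j\<in>{1..n}. real n * (real (n - 1 choose (j - 1)) * bell (n - j)))"
    proof (rule sum.cong)
      fix j assume "j \<in> {1..n}"
      then have "j * (n choose j) = n * (n - 1 choose (j - 1))"
        by (intro times_binomial_minus1_eq) auto
      then have "real j * real (n choose j) = real n * real (n - 1 choose (j - 1))"
        by (metis of_nat_mult)
      then show "real j * ?t j = real n * (real (n - 1 choose (j - 1)) * bell (n - j))"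
        by (metis mult.assoc)
    qed simp
    also have "\<dots> = real n * (\<Sum>j\<in>{1..n}. real (n - 1 choose (j - 1)) * bell (n - j))"
      by (simp add: sum_distrib_left)
    also have "(\<Sum>j\<in>{1..n}. real (n - 1 choose (j - 1)) * bell (n - j))
        = (\<Sum>j\<le>n - 1. real (n - 1 choose j) * bell j)"
    proof (rule sum.reindex_bij_witness[of _ "\<lambda>j. n - j" "\<lambda>j. n - j"])
      fix j assume "j \<in> {1..n}"
      then have "(n - 1) - (j - 1) = n - j" "j - 1 \<le> n - 1" by auto
      then show "real (n - 1 choose (n - j)) * bell (n - j)
          = real (n - 1 choose (j - 1)) * bell (n - j)"
        by (metis binomial_symmetric)
    qed (use assms in auto)
    also have "\<dots> = bell n" using bell_binomial[of "n - 1"] assms by simp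
    finally show ?thesis using assms by (simp add: field_simps)
  qed
  also have "(\<Sum>j\<le>s. ?t j) \<le> (\<Sum>j\<le>s. (real n / bell_ratio (n - s)) ^ j * bell n)"
  proof (rule sum_mono)
    fix j assume j: "j \<in> {..s}"
    let ?r = "bell_ratio (n - s)"
    have r: "?r > 0" "?r \<le> bell_ratio (n - j)"
      using bell_ratio_ge_1[of "n - s"] j incseqD[OF incseq_bell_ratio, of "n-s" "n-j"] by auto
    have "bell (n - j) * ?r ^ j \<le> bell (n - j) * bell_ratio (n - j) ^ j"
      using r bell_pos[of "n-j"] by (intro mult_left_mono power_mono) auto
    also have "\<dots> \<le> bell n" using bell_add_ge[of "n - j" j] j assms by simp
    finally have *: "bell (n - j) \<le> bell n / ?r ^ j" using r by (simp add: field_simps)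
    have "real (n choose j) \<le> real n ^ j"
      using binomial_le_pow2 j assms by (metis atMost_iff binomial_le_pow le_trans of_nat_le_iff of_nat_power)
    then have "?t j \<le> real n ^ j * (bell n / ?r ^ j)"
      using * bell_pos[of "n-j"] by (intro mult_mono) auto
    then show "?t j \<le> (real n / ?r) ^ j * bell n" by (simp add: power_divide)
  qed
  finally have "bell (Suc n) \<le> (\<Sum>j\<le>s. (real n / bell_ratio (n - s)) ^ j) * bell n + real n / real s * bell n"
    by (simp add: sum_distrib_right)
  then show ?thesis using bell_pos[of n] unfolding bell_ratio_def[of n] by (simp add: field_simps)
qed

text \<open>
  If \<open>bell_ratio n > e n\<close> with \<open>n\<close> large compared with \<open>s\<close>, then \<open>bell_ratio (n - s) \<ge> e n / 2\<close>,
  since one step increases the ratio by at most \<open>1\<close>. Then the finite sum in \<open>bell_ratio_le\<close> is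
  bounded independently of \<open>n\<close>, so with \<open>s \<ge> 4 / e\<close> that lemma yields
  \<open>bell_ratio n \<le> e n / 4 + C\<close>, which is impossible for large \<open>n\<close>.
\<close>

lemma bell_ratio_sublinear: "(\<lambda>n. bell_ratio n / real n) \<longlonglongrightarrow> 0"
proof (rule LIMSEQ_I, goal_cases)
  case (1 \<epsilon>)
  define e where "e = \<epsilon> / 2"
  have e: "e > 0" using 1 by (simp add: e_def)
  define s where "s = nat \<lceil>4 / e\<rceil>"
  have s: "real s \<ge> 4 / e" "s > 0" using e by (auto simp: s_def)
  define C where "C = (\<Sum>j\<le>s. (2 / e) ^ j)"
  have C: "C \<ge> 0" unfolding C_def using e by (intro sum_nonneg) auto
  define N where "N = nat \<lceil>max (2 * real s / e) (2 * C / e)\<rceil> + s + 1"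
  show ?case
  proof (intro exI[of _ N] allI impI)
    fix n assume n: "n \<ge> N"
    have nN: "real n \<ge> 2 * real s / e" "real n \<ge> 2 * C / e" "s \<le> n" "n > 0"
    proof -
      have "real n \<ge> max (2 * real s / e) (2 * C / e)"
        using n unfolding N_def by linarith
      then show "real n \<ge> 2 * real s / e" "real n \<ge> 2 * C / e" by auto
      show "s \<le> n" "n > 0" using n by (auto simp: N_def)
    qed
    have "bell_ratio n \<le> e * real n"
    proof (rule ccontr)
      assume "\<not> ?thesis"
      then have big: "bell_ratio n > e * real n" by simp
      have "bell_ratio n \<le> bell_ratio (n - s) + real s"
        using bell_ratio_add_le[of "n - s" s] nN by simp
      moreover have "real s \<le> e * real n / 2" using nN e by (simp add: field_simps)
      ultimately have "bell_ratio (n - s) \<ge> e * real n / 2" using big by linarith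
      then have "real n / bell_ratio (n - s) \<le> 2 / e"
        using e nN bell_ratio_ge_1[of "n - s"] by (simp add: field_simps)
      then have "(\<Sum>j\<le>s. (real n / bell_ratio (n - s)) ^ j) \<le> C"
        unfolding C_def using bell_ratio_ge_1[of "n - s"] by (intro sum_mono power_mono) auto
      moreover have "real n / real s \<le> e * real n / 4" using s e nN by (simp add: field_simps)
      ultimately have "bell_ratio n \<le> e * real n / 4 + C"
        using bell_ratio_le[OF s(2) nN(3)] by linarith
      also have "C \<le> e * real n / 2" using nN e by (simp add: field_simps)
      finally show False using big e nN by (simp add: field_simps)
    qed
    then have "bell_ratio n / real n \<le> e" using nN by (simp add: field_simps)
    moreover have "e < \<epsilon>" using 1 by (simp add: e_def)
    ultimately have "bell_ratio n / real n < \<epsilon>" by linarith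
    moreover have "bell_ratio n / real n \<ge> 0" using bell_ratio_ge_1[of n] by simp
    ultimately show "norm (bell_ratio n / real n - 0) < \<epsilon>" by simp
  qed
qed

section \<open>Merging two blocks\<close>

lemma partition_on_merge:
  assumes P: "partition_on A P" "B \<in> P" "C \<in> P"
  shows "partition_on A (insert (B \<union> C) (P - {B, C}))"
proof (rule partition_onI)
  show "\<Union>(insert (B \<union> C) (P - {B, C})) = A"
    using P by (auto simp: partition_on_def)
  show "{} \<notin> insert (B \<union> C) (P - {B, C})"
    using P by (auto simp: partition_on_def)
  show "disjnt p q" if "p \<in> insert (B \<union> C) (P - {B, C})" "q \<in> insert (B \<union> C) (P - {B, C})" "p \<noteq> q" for p q
    using that P by (auto simp: disjnt_iff dest: same_block)
qed

lemma partition_on_split: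
  assumes P: "partition_on A P" "U \<in> P" and S: "S \<subseteq> U" "S \<noteq> {}" "S \<noteq> U"
  shows "partition_on A (insert S (insert (U - S) (P - {U})))"
proof (rule partition_onI)
  show "\<Union>(insert S (insert (U - S) (P - {U}))) = A"
    using P S by (auto simp: partition_on_def)
  show "{} \<notin> insert S (insert (U - S) (P - {U}))"
    using P S by (auto simp: partition_on_def)
  show "disjnt p q" if "p \<in> insert S (insert (U - S) (P - {U}))"
      "q \<in> insert S (insert (U - S) (P - {U}))" "p \<noteq> q" for p q
    using that P S by (auto simp: disjnt_iff dest: same_block)
qed

text \<open>
  A partition with an ordered pair of distinct blocks \<open>B, C\<close> is the same thing as a partition
  with one block \<open>U = B \<union> C\<close> together with a splitting of \<open>U\<close> into two nonempty parts. So the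
  average over all partitions contains, for every \<open>U\<close>, the average over all splittings of \<open>U\<close>;
  this exact symmetry plays the role that independence plays for random words.
\<close>

lemma sum_partitions_merge:
  fixes F :: "'a set set \<Rightarrow> 'a set \<Rightarrow> 'a set \<Rightarrow> 'b::comm_monoid_add"
  assumes fin: "finite A"
  shows "(\<Sum>P\<in>partitions_of A. \<Sum>B\<in>P. \<Sum>C\<in>P - {B}. F (P - {B, C}) B C) =
         (\<Sum>P\<in>partitions_of A. \<Sum>U\<in>P. \<Sum>S\<in>Pow U - {{}, U}. F (P - {U}) S (U - S))"
proof -
  note finparts = finitely_many_partition_on[OF fin]
  have finP: "finite P" if "partition_on A P" for P
    using that fin finite_elements by blast
  have finU: "finite U" if "partition_on A P" "U \<in> P" for P U
    using partition_on_remove_block[OF that] fin finite_subset by blast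
  have "(\<Sum>P\<in>partitions_of A. \<Sum>B\<in>P. \<Sum>C\<in>P - {B}. F (P - {B, C}) B C)
      = (\<Sum>P\<in>partitions_of A. \<Sum>(B, C)\<in>Sigma P (\<lambda>B. P - {B}). F (P - {B, C}) B C)"
    by (intro sum.cong sum.Sigma) (auto simp: finP)
  also have "\<dots> = (\<Sum>(P, B, C)\<in>Sigma (partitions_of A) (\<lambda>P. Sigma P (\<lambda>B. P - {B})). F (P - {B, C}) B C)"
    by (subst sum.Sigma) (auto simp: finparts finP split_def intro!: finite_SigmaI)
  also have "\<dots> = (\<Sum>(P, U, S)\<in>Sigma (partitions_of A) (\<lambda>P. Sigma P (\<lambda>U. Pow U - {{}, U})).
      F (P - {U}) S (U - S))"
  proof (rule sum.reindex_bij_witness[of _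
        "\<lambda>(P, U, S). (insert S (insert (U - S) (P - {U})), S, U - S)"
        "\<lambda>(P, B, C). (insert (B \<union> C) (P - {B, C}), B \<union> C, B)"], goal_cases)
    case (1 x)
    then obtain P B C where x: "x = (P, B, C)" and P: "partition_on A P" "B \<in> P" "C \<in> P" "B \<noteq> C"
      by auto
    have "B \<union> C - B = C" "insert B (insert C (P - {B, C})) = P"
      using P by (auto dest: same_block)
    moreover have "B \<union> C \<notin> P - {B, C}"
      using P same_block[of A P "B \<union> C" B] partition_on_remove_block[of A P B] by fastforce
    ultimately show ?case using x by auto
  next
    case (2 x)
    then obtain P B C where x: "x = (P, B, C)" and P: "partition_on A P" "B \<in> P" "C \<in> P" "B \<noteq> C"
      by auto
    have "B \<noteq> {}" "B \<noteq> B \<union> C"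
      using P partition_on_remove_block[of A P] same_block[OF P(1-3)] by blast+
    then show ?case using x partition_on_merge[OF P(1-3)] by simp
  next
    case (3 x)
    then obtain P U S where x: "x = (P, U, S)"
        and P: "partition_on A P" "U \<in> P" "S \<subseteq> U" "S \<noteq> {}" "S \<noteq> U"
      by auto
    have "S \<notin> P - {U}" "U - S \<notin> P - {U}"
      using P same_block[of A P _ U] by blast+
    then have "insert S (insert (U - S) (P - {U})) - {S, U - S} = P - {U}" by auto
    moreover have "S \<union> (U - S) = U" "insert U (P - {U}) = P" using P by auto
    ultimately show ?case using x by simp
  next
    case (4 x)
    then obtain P U S where x: "x = (P, U, S)"
        and P: "partition_on A P" "U \<in> P" "S \<subseteq> U" "S \<noteq> {}" "S \<noteq> U"
      by auto
    have "U - S \<noteq> S" using P by blast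
    then show ?case using x partition_on_split[OF P] by simp
  next
    case (5 x)
    then obtain P B C where x: "x = (P, B, C)" and P: "partition_on A P" "B \<in> P" "C \<in> P" "B \<noteq> C"
      by auto
    have "B \<union> C - B = C" using P by (auto dest: same_block)
    moreover have "B \<union> C \<notin> P - {B, C}"
      using P same_block[of A P "B \<union> C" B] partition_on_remove_block[of A P B] by fastforce
    ultimately show ?case using x by simp
  qed
  also have "\<dots> = (\<Sum>P\<in>partitions_of A. \<Sum>(U, S)\<in>Sigma P (\<lambda>U. Pow U - {{}, U}). F (P - {U}) S (U - S))"
    by (subst sum.Sigma) (auto simp: finparts finP finU split_def intro!: finite_SigmaI)
  also have "\<dots> = (\<Sum>P\<in>partitions_of A. \<Sum>U\<in>P. \<Sum>S\<in>Pow U - {{}, U}. F (P - {U}) S (U - S))"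
    by (intro sum.cong sum.Sigma[symmetric]) (auto simp: finP finU)
  finally show ?thesis .
qed

section \<open>The balance of two blocks\<close>

lemma finite_block_arcs: "finite U \<Longrightarrow> finite (block_arcs U)"
  by (rule finite_subset[of _ "U \<times> U"]) (auto simp: block_arcs_def)

lemma ex_block_arc_from:
  assumes "finite U" "x \<in> U" "y \<in> U" "x < y"
  shows "\<exists>z. (x, z) \<in> block_arcs U \<and> z \<le> y"
proof -
  let ?M = "{z\<in>U. x < z}"
  have fin: "finite ?M" using assms by simp
  have "Min ?M \<in> ?M" using assms by (intro Min_in) auto
  moreover have "\<not> w < Min ?M" if "w \<in> U" "x < w" for w using fin that by (simp add: leD)
  ultimately have "(x, Min ?M) \<in> block_arcs U" using assms by (auto simp: block_arcs_def)
  moreover have "Min ?M \<le> y" using fin assms by simp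
  ultimately show ?thesis by blast
qed

lemma ex_block_arc_to:
  assumes "finite U" "x \<in> U" "y \<in> U" "x < y"
  shows "\<exists>z. (z, y) \<in> block_arcs U \<and> x \<le> z"
proof -
  let ?M = "{z\<in>U. z < y}"
  have fin: "finite ?M" using assms by simp
  have "Max ?M \<in> ?M" using assms by (intro Max_in) auto
  moreover have "\<not> Max ?M < w" if "w \<in> U" "w < y" for w using fin that by (simp add: leD)
  ultimately have "(Max ?M, y) \<in> block_arcs U" using assms by (auto simp: block_arcs_def)
  moreover have "x \<le> Max ?M" using fin assms by simp
  ultimately show ?thesis by blast
qed

lemma card_block_arcs:
  assumes "finite U" "U \<noteq> {}"
  shows "card (block_arcs U) + 1 = card U"
proof -
  have "inj_on fst (block_arcs U)"
  proof (rule inj_onI)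
    fix p q assume "p \<in> block_arcs U" "q \<in> block_arcs U" "fst p = fst q"
    then show "p = q"
      by (cases p, cases q) (auto simp: block_arcs_def, meson linorder_less_linear)
  qed
  moreover have "fst ` block_arcs U = U - {Max U}"
  proof
    show "fst ` block_arcs U \<subseteq> U - {Max U}"
      using assms by (auto simp: block_arcs_def) (meson Max_ge leD)
    show "U - {Max U} \<subseteq> fst ` block_arcs U"
    proof
      fix x assume "x \<in> U - {Max U}"
      then have "x \<in> U" "x < Max U" "Max U \<in> U" using assms by (auto simp: order.strict_iff_order)
      then show "x \<in> fst ` block_arcs U"
        using ex_block_arc_from[of U x "Max U"] assms by force
    qed
  qed
  ultimately have "card (block_arcs U) = card (U - {Max U})" by (metis card_image)
  moreover have "card (U - {Max U}) + 1 = card U"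
    using assms card_Suc_Diff1[of U "Max U"] by simp
  ultimately show ?thesis by simp
qed

text \<open>
  For disjoint \<open>S\<close> and \<open>T\<close>, each pair of neighbours in \<open>S \<union> T\<close> counts \<open>1\<close> if it lies in one of
  the two sets and \<open>-1\<close> if it alternates between them.
\<close>

definition balance :: "nat set \<Rightarrow> nat set \<Rightarrow> real" where
  "balance S T = (\<Sum>(x, y)\<in>block_arcs (S \<union> T). if x \<in> S \<longleftrightarrow> y \<in> S then 1 else -1)"

lemma abs_balance_le: "finite S \<Longrightarrow> finite T \<Longrightarrow> \<bar>balance S T\<bar> \<le> real (card S) + real (card T)"
proof -
  assume fin: "finite S" "finite T"
  have "\<bar>balance S T\<bar> \<le> (\<Sum>(x, y)\<in>block_arcs (S \<union> T). 1)"
    unfolding balance_def 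
    by (rule order_trans[OF sum_abs], rule sum_mono) (simp add: split_def)
  also have "\<dots> = real (card (block_arcs (S \<union> T)))" by (simp add: split_def)
  also have "\<dots> \<le> real (card (S \<union> T))"
    using card_block_arcs[of "S \<union> T"] fin by (cases "S \<union> T = {}") (auto simp: block_arcs_def)
  also have "\<dots> \<le> real (card S) + real (card T)"
    using card_Un_le[of S T] by linarith
  finally show ?thesis .
qed

text \<open>
  Moving the left end of a fixed pair of neighbours to the other part changes the sign of
  the pair, so each pair contributes zero on average over all splittings.
\<close>

lemma sum_balance_Pow:
  assumes fin: "finite U"
  shows "(\<Sum>S\<in>Pow U. balance S (U - S)) = 0"
proof -
  let ?sg = "\<lambda>S (x, y). if x \<in> S \<longleftrightarrow> y \<in> S then 1 else (-1::real)"
  have "(\<Sum>S\<in>Pow U. balance S (U - S)) = (\<Sum>S\<in>Pow U. \<Sum>e\<in>block_arcs U. ?sg S e)"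
    by (rule sum.cong) (auto simp: balance_def Un_absorb1)
  also have "\<dots> = (\<Sum>e\<in>block_arcs U. \<Sum>S\<in>Pow U. ?sg S e)" by (rule sum.swap)
  also have "\<dots> = 0"
  proof (rule sum.neutral, rule ballI)
    fix e assume "e \<in> block_arcs U"
    moreover obtain x y where e: "e = (x, y)" by (cases e)
    ultimately have xy: "x \<in> U" "x \<noteq> y" by (auto simp: block_arcs_def)
    show "(\<Sum>S\<in>Pow U. ?sg S e) = 0" unfolding e
      by (rule sum_involution_eq_0[where h = "\<lambda>S. if x \<in> S then S - {x} else insert x S"])
         (use xy in auto)
  qed
  finally show ?thesis .
qed

lemma balance_trivial:
  assumes "finite U" "U \<noteq> {}"
  shows "balance {} U = real (card U) - 1" "balance U {} = real (card U) - 1"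
proof -
  have "real (card (block_arcs U)) = real (card U) - 1"
    using card_block_arcs[OF assms] by linarith
  moreover have "balance U {} = (\<Sum>e\<in>block_arcs U. 1)"
    unfolding balance_def by (rule sum.cong) (auto simp: block_arcs_def)
  ultimately show "balance {} U = real (card U) - 1" "balance U {} = real (card U) - 1"
    by (auto simp: balance_def split_def)
qed

text \<open>
  Only the two splittings with an empty part are missing from the vanishing sum over all
  splittings, and for them every pair of neighbours counts \<open>1\<close>.
\<close>

lemma sum_balance_splits:
  assumes "finite U" "U \<noteq> {}"
  shows "(\<Sum>S\<in>Pow U - {{}, U}. balance S (U - S)) = - 2 * (real (card U) - 1)"
proof -
  have "(\<Sum>S\<in>Pow U - {{}, U}. balance S (U - S)) =
      (\<Sum>S\<in>Pow U. balance S (U - S)) - (\<Sum>S\<in>{{}, U}. balance S (U - S))"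
    by (rule sum_diff) (use assms in auto)
  also have "(\<Sum>S\<in>{{}, U}. balance S (U - S)) = balance {} U + balance U {}"
    using assms by (subst sum.insert) auto
  finally show ?thesis using assms by (simp add: sum_balance_Pow balance_trivial)
qed

definition total_balance :: "nat set set \<Rightarrow> real" where
  "total_balance P = (\<Sum>B\<in>P. \<Sum>C\<in>P - {B}. balance B C)"

lemma sum_swap_distinct:
  fixes f :: "'a \<Rightarrow> 'a \<Rightarrow> 'b::comm_monoid_add"
  assumes "finite A"
  shows "(\<Sum>a\<in>A. \<Sum>b\<in>A - {a}. f a b) = (\<Sum>b\<in>A. \<Sum>a\<in>A - {b}. f a b)"
proof -
  have "(\<Sum>a\<in>A. \<Sum>b\<in>A - {a}. f a b) = (\<Sum>a\<in>A. \<Sum>b\<in>{b. b \<in> A \<and> a \<noteq> b}. f a b)"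
    by (intro sum.cong) auto
  also have "\<dots> = (\<Sum>b\<in>A. \<Sum>a\<in>{a. a \<in> A \<and> a \<noteq> b}. f a b)"
    using assms by (rule sum.swap_restrict[OF _ assms])
  also have "\<dots> = (\<Sum>b\<in>A. \<Sum>a\<in>A - {b}. f a b)"
    by (intro sum.cong) auto
  finally show ?thesis .
qed

text \<open>
  Merging \<open>B\<close> and \<open>C\<close> leaves \<open>G (P - {B, C})\<close> unchanged, so the inner sum over the splittings of
  \<open>B \<union> C\<close> nearly cancels.
\<close>

lemma sum_partitions_balance:
  fixes G :: "nat set set \<Rightarrow> real"
  assumes fin: "finite A"
  shows "(\<Sum>P\<in>partitions_of A. \<Sum>B\<in>P. \<Sum>C\<in>P - {B}. balance B C * G (P - {B, C})) =
         - 2 * (\<Sum>P\<in>partitions_of A. \<Sum>U\<in>P. (real (card U) - 1) * G (P - {U}))"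
proof -
  have "(\<Sum>P\<in>partitions_of A. \<Sum>B\<in>P. \<Sum>C\<in>P - {B}. balance B C * G (P - {B, C}))
      = (\<Sum>P\<in>partitions_of A. \<Sum>U\<in>P. \<Sum>S\<in>Pow U - {{}, U}. balance S (U - S) * G (P - {U}))"
    using sum_partitions_merge[OF fin, of "\<lambda>R B C. balance B C * G R"] .
  also have "\<dots> = (\<Sum>P\<in>partitions_of A. \<Sum>U\<in>P. - 2 * (real (card U) - 1) * G (P - {U}))"
  proof (intro sum.cong refl)
    fix P U assume "P \<in> partitions_of A" "U \<in> P"
    then have "finite U" "U \<noteq> {}"
      using partition_on_remove_block[of A P U] fin finite_subset by auto
    then show "(\<Sum>S\<in>Pow U - {{}, U}. balance S (U - S) * G (P - {U})) = - 2 * (real (card U) - 1) * G (P - {U})"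
      by (subst sum_distrib_right[symmetric], subst sum_balance_splits) auto
  qed
  also have "\<dots> = - 2 * (\<Sum>P\<in>partitions_of A. \<Sum>U\<in>P. (real (card U) - 1) * G (P - {U}))"
    by (simp only: sum_distrib_left mult.assoc)
  finally show ?thesis .
qed

lemma sum_card_blocks:
  assumes "finite A" "partition_on A P"
  shows "(\<Sum>B\<in>P. real (card B)) = real (card A)"
proof -
  have "finite B" if "B \<in> P" for B
    using partition_on_remove_block[OF assms(2) that] assms(1) finite_subset by blast
  then have "card A = (\<Sum>B\<in>P. card B)"
    by (rule product_partition[OF assms(2)])
  then show ?thesis by simp
qed

text \<open>
  The cancellation is applied twice. It replaces \<open>balance B C\<close> by \<open>-2 (card U - 1)\<close>; after an
  exchange of summations the remaining factor \<open>balance D E\<close> is treated in the same way. What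
  is left is four times a sum of products \<open>(card V - 1) (card U - 1)\<close> over distinct blocks of one
  partition, and such a sum is at most the square of the number of points. So the balances of
  disjoint pairs of blocks are almost uncorrelated.
\<close>

lemma sum_balance_disjoint_pairs:
  assumes fin: "finite A"
  shows "(\<Sum>P\<in>partitions_of A. \<Sum>B\<in>P. \<Sum>C\<in>P - {B}. balance B C * total_balance (P - {B, C}))
         \<le> 4 * (real (card A))\<^sup>2 * real (card (partitions_of A))"
proof -
  define h :: "nat set \<Rightarrow> real" where "h U = real (card U) - 1" for U
  define H where "H R = (\<Sum>U\<in>R. h U)" for R
  have swap: "(\<Sum>U\<in>P. h U * total_balance (P - {U})) = (\<Sum>D\<in>P. \<Sum>E\<in>P - {D}. balance D E * H (P - {D, E}))"
    if "finite P" for P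
  proof -
    have "(\<Sum>U\<in>P. h U * total_balance (P - {U}))
        = (\<Sum>U\<in>P. \<Sum>D\<in>P - {U}. \<Sum>E\<in>P - {U} - {D}. h U * balance D E)"
      by (simp add: total_balance_def sum_distrib_left)
    also have "\<dots> = (\<Sum>D\<in>P. \<Sum>U\<in>P - {D}. \<Sum>E\<in>P - {U} - {D}. h U * balance D E)"
      by (rule sum_swap_distinct[OF that])
    also have "\<dots> = (\<Sum>D\<in>P. \<Sum>U\<in>P - {D}. \<Sum>E\<in>P - {D} - {U}. h U * balance D E)"
      by (intro sum.cong refl) auto
    also have "\<dots> = (\<Sum>D\<in>P. \<Sum>E\<in>P - {D}. \<Sum>U\<in>P - {D} - {E}. h U * balance D E)"
      by (intro sum.cong refl sum_swap_distinct) (use that in auto)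
    also have "\<dots> = (\<Sum>D\<in>P. \<Sum>E\<in>P - {D}. balance D E * H (P - {D, E}))"
      by (intro sum.cong refl)
         (simp add: H_def sum_distrib_left mult.commute Diff_insert2[symmetric] insert_commute)
    finally show ?thesis .
  qed
  have "(\<Sum>P\<in>partitions_of A. \<Sum>B\<in>P. \<Sum>C\<in>P - {B}. balance B C * total_balance (P - {B, C}))
      = - 2 * (\<Sum>P\<in>partitions_of A. \<Sum>U\<in>P. h U * total_balance (P - {U}))"
    unfolding h_def by (rule sum_partitions_balance[OF fin])
  also have "(\<Sum>P\<in>partitions_of A. \<Sum>U\<in>P. h U * total_balance (P - {U}))
      = (\<Sum>P\<in>partitions_of A. \<Sum>D\<in>P. \<Sum>E\<in>P - {D}. balance D E * H (P - {D, E}))"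
    by (intro sum.cong refl swap) (use fin finite_elements in auto)
  also have "\<dots> = - 2 * (\<Sum>P\<in>partitions_of A. \<Sum>V\<in>P. h V * H (P - {V}))"
    unfolding h_def by (rule sum_partitions_balance[OF fin])
  also have "- 2 * \<dots> = 4 * (\<Sum>P\<in>partitions_of A. \<Sum>V\<in>P. h V * H (P - {V}))" by simp
  also have "(\<Sum>P\<in>partitions_of A. \<Sum>V\<in>P. h V * H (P - {V}))
      \<le> (\<Sum>P\<in>partitions_of A. (real (card A))\<^sup>2)"
  proof (rule sum_mono)
    fix P assume "P \<in> partitions_of A"
    then have P: "partition_on A P" by simp
    have finP: "finite P" using P fin finite_elements by blast
    have h: "0 \<le> h U" "h U \<le> real (card U)" if "U \<in> P" for U
    proof -
      have "finite U" "U \<noteq> {}" using partition_on_remove_block[OF P that] fin finite_subset by auto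
      then have "card U \<ge> 1" by (simp add: Suc_leI card_gt_0_iff)
      then show "0 \<le> h U" "h U \<le> real (card U)" by (auto simp: h_def)
    qed
    have H: "H P \<le> real (card A)"
      unfolding H_def using sum_card_blocks[OF fin P] sum_mono[of P h "\<lambda>U. real (card U)"] h by simp
    have "(\<Sum>V\<in>P. h V * H (P - {V})) \<le> (\<Sum>V\<in>P. h V * H P)"
    proof (rule sum_mono)
      fix V assume "V \<in> P"
      then have "H (P - {V}) \<le> H P" unfolding H_def using h finP by (intro sum_mono2) auto
      then show "h V * H (P - {V}) \<le> h V * H P" using h \<open>V \<in> P\<close> by (intro mult_left_mono) auto
    qed
    also have "\<dots> = (H P)\<^sup>2" by (simp add: H_def power2_eq_square sum_distrib_right)
    also have "\<dots> \<le> (real (card A))\<^sup>2" using H h by (intro power_mono) (auto simp: H_def sum_nonneg)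
    finally show "(\<Sum>V\<in>P. h V * H (P - {V})) \<le> (real (card A))\<^sup>2" .
  qed
  finally show ?thesis by (simp add: mult_ac)
qed

section \<open>The second moment of the total balance\<close>

text \<open>
  The pairs lost by removing \<open>B\<close> and \<open>C\<close> have one of these two blocks as a component.
\<close>

lemma total_balance_diff_le:
  assumes fin: "finite A" and P: "partition_on A P" and BC: "B \<in> P" "C \<in> P"
  shows "\<bar>total_balance P - total_balance (P - {B, C})\<bar>
         \<le> 2 * real (card P) * (real (card B) + real (card C)) + 4 * real (card A)"
proof -
  let ?c = "\<lambda>B. real (card B)"
  have finP: "finite P" using fin P finite_elements by blast
  have finU: "finite U" if "U \<in> P" for U
    using partition_on_remove_block[OF P that] fin finite_subset by blast
  define D where "D R = Sigma R (\<lambda>B. R - {B})" for R :: "nat set set"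
  have tb: "total_balance R = (\<Sum>(B, C)\<in>D R. balance B C)" if "R \<subseteq> P" for R
    unfolding total_balance_def D_def using that finP
    by (intro sum.Sigma) (auto intro: finite_subset)
  have "total_balance P - total_balance (P - {B, C}) = (\<Sum>(B, C)\<in>D P - D (P - {B, C}). balance B C)"
    unfolding tb[OF order_refl] tb[OF Diff_subset]
    by (rule sum_diff[symmetric]) (auto simp: D_def finP)
  also have "\<bar>\<dots>\<bar> \<le> (\<Sum>(U, V)\<in>D P - D (P - {B, C}). ?c U + ?c V)"
    by (rule order_trans[OF sum_abs], rule sum_mono)
       (auto simp: D_def intro!: abs_balance_le finU)
  also have "\<dots> \<le> (\<Sum>(U, V)\<in>{B, C} \<times> P \<union> P \<times> {B, C}. ?c U + ?c V)"
    using BC by (intro sum_mono2) (auto simp: D_def finP)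
  also have "\<dots> \<le> (\<Sum>(U, V)\<in>{B, C} \<times> P. ?c U + ?c V) + (\<Sum>(U, V)\<in>P \<times> {B, C}. ?c U + ?c V)"
  proof -
    have "(\<Sum>(U, V)\<in>({B, C} \<times> P) \<inter> (P \<times> {B, C}). ?c U + ?c V) \<ge> 0"
      by (intro sum_nonneg) auto
    then show ?thesis by (subst sum.union_inter[symmetric]) (auto simp: finP)
  qed
  also have "\<dots> = 2 * (\<Sum>U\<in>{B, C}. \<Sum>V\<in>P. ?c U + ?c V)"
  proof -
    have "(\<Sum>(U, V)\<in>P \<times> {B, C}. ?c U + ?c V) = (\<Sum>V\<in>{B, C}. \<Sum>U\<in>P. ?c U + ?c V)"
      unfolding sum.cartesian_product[symmetric] by (rule sum.swap)
    then show ?thesis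
      unfolding sum.cartesian_product[symmetric] by (simp add: add.commute)
  qed
  also have "(\<Sum>U\<in>{B, C}. \<Sum>V\<in>P. ?c U + ?c V) \<le> real (card P) * (?c B + ?c C) + 2 * real (card A)"
  proof -
    have *: "(\<Sum>V\<in>P. ?c U + ?c V) = real (card P) * ?c U + real (card A)" for U
      by (simp add: sum.distrib sum_card_blocks[OF fin P])
    show ?thesis
      unfolding * by (cases "B = C") (simp_all add: algebra_simps)
  qed
  finally show ?thesis by (simp add: algebra_simps)
qed

text \<open>
  The square is a sum over two pairs of blocks. Disjoint pairs are kept exactly, because they
  cancel on average; for pairs with a common block the trivial bound on the balance by the sizes
  suffices.
\<close>

lemma total_balance_square_le:
  assumes fin: "finite A" and P: "partition_on A P"
  defines "N \<equiv> real (card P)" and "n \<equiv> real (card A)" and "Q \<equiv> (\<Sum>B\<in>P. (real (card B))\<^sup>2)"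
  shows "(total_balance P)\<^sup>2
         \<le> (\<Sum>B\<in>P. \<Sum>C\<in>P - {B}. balance B C * total_balance (P - {B, C})) + 8 * N\<^sup>2 * Q + 8 * n\<^sup>2 * N"
proof -
  let ?c = "\<lambda>B. real (card B)"
  let ?e = "\<lambda>B C. (?c B + ?c C) * (2 * N * (?c B + ?c C) + 4 * n)"
  have finP: "finite P" using fin P finite_elements by blast
  have finU: "finite U" if "U \<in> P" for U
    using partition_on_remove_block[OF P that] fin finite_subset by blast
  have N: "N \<ge> 0" "n \<ge> 0" by (simp_all add: N_def n_def)
  have "(total_balance P)\<^sup>2 = (\<Sum>B\<in>P. \<Sum>C\<in>P - {B}. balance B C * total_balance P)"
    by (simp add: power2_eq_square sum_distrib_right[symmetric] total_balance_def)
  also have "\<dots> \<le> (\<Sum>B\<in>P. \<Sum>C\<in>P - {B}. balance B C * total_balance (P - {B, C}) + ?e B C)"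
  proof (intro sum_mono)
    fix B C assume BC: "B \<in> P" "C \<in> P - {B}"
    have "balance B C * (total_balance P - total_balance (P - {B, C}))
        \<le> \<bar>balance B C\<bar> * \<bar>total_balance P - total_balance (P - {B, C})\<bar>"
      unfolding abs_mult[symmetric] by simp
    also have "\<dots> \<le> ?e B C"
      using BC total_balance_diff_le[OF fin P, of B C] finU abs_balance_le[of B C]
      by (intro mult_mono) (auto simp: N_def n_def)
    finally show "balance B C * total_balance P \<le> balance B C * total_balance (P - {B, C}) + ?e B C"
      by (simp add: algebra_simps)
  qed
  also have "\<dots> = (\<Sum>B\<in>P. \<Sum>C\<in>P - {B}. balance B C * total_balance (P - {B, C})) + (\<Sum>B\<in>P. \<Sum>C\<in>P - {B}. ?e B C)"
    by (simp add: sum.distrib)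
  also have "(\<Sum>B\<in>P. \<Sum>C\<in>P - {B}. ?e B C) \<le> (\<Sum>B\<in>P. \<Sum>C\<in>P. ?e B C)"
    using finP N by (intro sum_mono sum_mono2) auto
  also have "\<dots> \<le> (\<Sum>B\<in>P. \<Sum>C\<in>P. 4 * N * (?c B)\<^sup>2 + 4 * N * (?c C)\<^sup>2 + 4 * n * ?c B + 4 * n * ?c C)"
  proof (intro sum_mono)
    fix B C
    have "(?c B + ?c C)\<^sup>2 \<le> 2 * (?c B)\<^sup>2 + 2 * (?c C)\<^sup>2"
      using sum_squares_bound[of "?c B" "?c C"] by (simp add: power2_sum)
    then have "2 * N * (?c B + ?c C)\<^sup>2 \<le> 2 * N * (2 * (?c B)\<^sup>2 + 2 * (?c C)\<^sup>2)"
      using N by (intro mult_left_mono) auto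
    then show "?e B C \<le> 4 * N * (?c B)\<^sup>2 + 4 * N * (?c C)\<^sup>2 + 4 * n * ?c B + 4 * n * ?c C"
      by (simp add: algebra_simps power2_eq_square)
  qed
  also have "\<dots> = 8 * N\<^sup>2 * Q + 8 * n\<^sup>2 * N"
  proof -
    have n: "(\<Sum>B\<in>P. ?c B) = n" unfolding n_def by (rule sum_card_blocks[OF fin P])
    have "(\<Sum>C\<in>P. 4 * N * (?c B)\<^sup>2 + 4 * N * (?c C)\<^sup>2 + 4 * n * ?c B + 4 * n * ?c C)
        = 4 * N\<^sup>2 * (?c B)\<^sup>2 + 4 * N * Q + 4 * n * N * ?c B + 4 * n\<^sup>2" for B
      by (simp add: sum.distrib sum_distrib_left[symmetric] n Q_def[symmetric] N_def[symmetric]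
          power2_eq_square[of N] power2_eq_square[of n])
    then show ?thesis
      by (simp add: sum.distrib sum_distrib_left[symmetric] n Q_def[symmetric] N_def[symmetric]
          power2_eq_square[of N] power2_eq_square[of n])
  qed
  finally show ?thesis by simp
qed

lemma sum_partitions_card_le_bell:
  assumes "finite A"
  shows "(\<Sum>P\<in>partitions_of A. (real (card P) + 1)\<^sup>2) \<le> bell (Suc (Suc (card A)))"
proof -
  have "(\<Sum>P\<in>partitions_of A. (real (card P) + 1)\<^sup>2) \<le> (\<Sum>P\<in>partitions_of A. (real (card P) + 1)\<^sup>2 + 1)"
    by (intro sum_mono) simp
  also have "\<dots> = sum_by_card (card A) (\<lambda>m. (real m + 1)\<^sup>2 + 1)"
    by (rule sum_partitions_card[OF assms])
  also have "\<dots> = bell (Suc (Suc (card A)))"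
    unfolding bell_Suc_Suc by (rule sum_set_partitions_card[symmetric])
  finally show ?thesis .
qed

text \<open>
  Inserting \<open>a\<close> last, its block has on average over the choices about \<open>card A / card P\<close> points.
  This gains the factor that makes the squares of the block sizes negligible.
\<close>

lemma sum_partitions_block_containing:
  assumes fin: "finite A" and a: "a \<in> A"
  shows "(\<Sum>P\<in>partitions_of A. (real (card P))\<^sup>2 * (\<Sum>B\<in>{B\<in>P. a \<in> B}. real (card B)))
         \<le> 2 * real (card A) * bell (Suc (card A))"
proof -
  define A' where "A' = A - {a}"
  have A': "finite A'" "a \<notin> A'" "insert a A' = A" "card A = Suc (card A')"
    using assms card_Suc_Diff1[of A a] by (auto simp: A'_def simp del: card_Diff_insert)
  let ?F = "\<lambda>P. (real (card P))\<^sup>2 * (\<Sum>B\<in>{B\<in>P. a \<in> B}. real (card B))"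
  have "(\<Sum>P\<in>partitions_of A. ?F P)
      = (\<Sum>P\<in>partitions_of A'. ?F (insert {a} P) + (\<Sum>B\<in>P. ?F (insert (insert a B) (P - {B}))))"
    using sum_partitions_insert[OF A'(1,2), of ?F] unfolding A'(3) .
  also have "\<dots> \<le> (\<Sum>P\<in>partitions_of A'. 2 * real (card A) * (real (card P) + 1)\<^sup>2)"
  proof (rule sum_mono)
    fix P assume "P \<in> partitions_of A'"
    then have P: "partition_on A' P" by simp
    have finP: "finite P" using A' P finite_elements by blast
    have blk: "finite B" "a \<notin> B" "B \<noteq> {}" if "B \<in> P" for B
      using partition_on_remove_block[OF P that] A' finite_subset by auto
    let ?N = "real (card P)"
    have "{B\<in>insert {a} P. a \<in> B} = {{a}}" "{a} \<notin> P" using blk by auto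
    then have 1: "?F (insert {a} P) = (?N + 1)\<^sup>2" using finP by (simp add: add.commute)
    have 2: "?F (insert (insert a B) (P - {B})) = ?N\<^sup>2 * (real (card B) + 1)" if B: "B \<in> P" for B
    proof -
      have "{C\<in>insert (insert a B) (P - {B}). a \<in> C} = {insert a B}" using blk by auto
      moreover have "insert a B \<notin> P - {B}" using blk by auto
      then have "card (insert (insert a B) (P - {B})) = card P"
        using finP B card_Suc_Diff1[of P B] by simp
      ultimately show ?thesis using blk[OF B] by (simp add: add.commute)
    qed
    have N: "?N \<le> real (card A')"
    proof -
      have "(\<Sum>B\<in>P. 1) \<le> (\<Sum>B\<in>P. real (card B))"
        using blk by (intro sum_mono) (simp add: Suc_leI card_gt_0_iff)
      then show ?thesis using sum_card_blocks[OF A'(1) P] by simp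
    qed
    have "(\<Sum>B\<in>P. ?F (insert (insert a B) (P - {B}))) = (\<Sum>B\<in>P. ?N\<^sup>2 * (real (card B) + 1))"
      using 2 by (intro sum.cong) auto
    also have "\<dots> = ?N\<^sup>2 * (real (card A') + ?N)"
      by (simp add: sum_distrib_left[symmetric] sum.distrib sum_card_blocks[OF A'(1) P])
    also have "\<dots> \<le> (?N + 1)\<^sup>2 * (2 * real (card A'))"
      using N by (intro mult_mono power_mono) auto
    finally have "?F (insert {a} P) + (\<Sum>B\<in>P. ?F (insert (insert a B) (P - {B})))
        \<le> (?N + 1)\<^sup>2 * (1 + 2 * real (card A'))"
      unfolding 1 by (simp add: algebra_simps)
    also have "\<dots> \<le> (?N + 1)\<^sup>2 * (2 * real (card A))"
      using A' by (intro mult_left_mono) auto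
    finally show "?F (insert {a} P) + (\<Sum>B\<in>P. ?F (insert (insert a B) (P - {B})))
        \<le> 2 * real (card A) * (?N + 1)\<^sup>2" by (simp only: mult.commute)
  qed
  also have "\<dots> = 2 * real (card A) * (\<Sum>P\<in>partitions_of A'. (real (card P) + 1)\<^sup>2)"
    by (simp only: sum_distrib_left)
  also have "\<dots> \<le> 2 * real (card A) * bell (Suc (Suc (card A')))"
    using sum_partitions_card_le_bell[OF A'(1)] by (intro mult_left_mono) auto
  finally show ?thesis using A'(4) by simp
qed

text \<open>
  A block of size \<open>m\<close> is the block of each of its \<open>m\<close> points, so the sum of the squared sizes
  is the sum over all points of the size of the block containing it.
\<close>

lemma sum_partitions_squared_sizes:
  assumes fin: "finite A"
  shows "(\<Sum>P\<in>partitions_of A. (real (card P))\<^sup>2 * (\<Sum>B\<in>P. (real (card B))\<^sup>2))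
         \<le> 2 * (real (card A))\<^sup>2 * bell (Suc (card A))"
proof -
  have "(\<Sum>P\<in>partitions_of A. (real (card P))\<^sup>2 * (\<Sum>B\<in>P. (real (card B))\<^sup>2))
      = (\<Sum>P\<in>partitions_of A. \<Sum>a\<in>A. (real (card P))\<^sup>2 * (\<Sum>B\<in>{B\<in>P. a \<in> B}. real (card B)))"
  proof (rule sum.cong)
    fix P assume "P \<in> partitions_of A"
    then have P: "partition_on A P" by simp
    have finP: "finite P" using fin P finite_elements by blast
    have "(\<Sum>B\<in>P. (real (card B))\<^sup>2) = (\<Sum>B\<in>P. \<Sum>a\<in>{a\<in>A. a \<in> B}. real (card B))"
    proof (rule sum.cong)
      fix B assume "B \<in> P"
      then have "{a\<in>A. a \<in> B} = B" using partition_on_remove_block[OF P] by blast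
      then show "(real (card B))\<^sup>2 = (\<Sum>a\<in>{a\<in>A. a \<in> B}. real (card B))"
        by (simp add: power2_eq_square)
    qed simp
    also have "\<dots> = (\<Sum>a\<in>A. \<Sum>B\<in>{B\<in>P. a \<in> B}. real (card B))"
      by (rule sum.swap_restrict[OF finP fin])
    finally show "(real (card P))\<^sup>2 * (\<Sum>B\<in>P. (real (card B))\<^sup>2)
        = (\<Sum>a\<in>A. (real (card P))\<^sup>2 * (\<Sum>B\<in>{B\<in>P. a \<in> B}. real (card B)))"
      by (simp add: sum_distrib_left)
  qed simp
  also have "\<dots> = (\<Sum>a\<in>A. \<Sum>P\<in>partitions_of A. (real (card P))\<^sup>2 * (\<Sum>B\<in>{B\<in>P. a \<in> B}. real (card B)))"
    by (rule sum.swap)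
  also have "\<dots> \<le> (\<Sum>a\<in>A. 2 * real (card A) * bell (Suc (card A)))"
    by (intro sum_mono sum_partitions_block_containing fin)
  finally show ?thesis by (simp add: power2_eq_square mult_ac)
qed

lemma sum_total_balance_square:
  "(\<Sum>P\<in>set_partitions n. (total_balance P)\<^sup>2) \<le> 28 * (real n)\<^sup>2 * bell (Suc n)"
proof -
  let ?A = "{1..n}" and ?S = "set_partitions n"
  let ?N = "\<lambda>P. real (card P)" and ?Q = "\<lambda>P. \<Sum>B\<in>P. (real (card B))\<^sup>2"
  let ?D = "\<lambda>P. \<Sum>B\<in>P. \<Sum>C\<in>P - {B}. balance B C * total_balance (P - {B, C})"
  have S: "?S = partitions_of ?A" by (simp add: set_partitions_def)
  have "(\<Sum>P\<in>?S. (total_balance P)\<^sup>2) \<le> (\<Sum>P\<in>?S. ?D P + 8 * ((?N P)\<^sup>2 * ?Q P) + 8 * (real n)\<^sup>2 * ?N P)"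
  proof (rule sum_mono)
    fix P assume "P \<in> ?S"
    then show "(total_balance P)\<^sup>2 \<le> ?D P + 8 * ((?N P)\<^sup>2 * ?Q P) + 8 * (real n)\<^sup>2 * ?N P"
      using total_balance_square_le[of ?A P] by (simp add: S mult.assoc)
  qed
  also have "\<dots> = (\<Sum>P\<in>?S. ?D P) + 8 * (\<Sum>P\<in>?S. (?N P)\<^sup>2 * ?Q P) + 8 * (real n)\<^sup>2 * (\<Sum>P\<in>?S. ?N P)"
    by (simp only: sum.distrib sum_distrib_left)
  also have "\<dots> \<le> 4 * (real n)\<^sup>2 * bell (Suc n) + 8 * (2 * (real n)\<^sup>2 * bell (Suc n))
      + 8 * (real n)\<^sup>2 * bell (Suc n)"
  proof (intro add_mono mult_left_mono)
    have "(\<Sum>P\<in>?S. ?D P) \<le> 4 * (real n)\<^sup>2 * bell n"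
      using sum_balance_disjoint_pairs[of ?A] by (simp add: S bell_def)
    also have "\<dots> \<le> 4 * (real n)\<^sup>2 * bell (Suc n)"
      using bell_ratio_ge_1[of n] bell_pos[of n] by (intro mult_left_mono) (auto simp: bell_Suc_eq)
    finally show "(\<Sum>P\<in>?S. ?D P) \<le> 4 * (real n)\<^sup>2 * bell (Suc n)" .
    show "(\<Sum>P\<in>?S. (?N P)\<^sup>2 * ?Q P) \<le> 2 * (real n)\<^sup>2 * bell (Suc n)"
      using sum_partitions_squared_sizes[of ?A] by (simp add: S)
    show "(\<Sum>P\<in>?S. ?N P) \<le> bell (Suc n)"
      unfolding bell_Suc by (intro sum_mono) simp
  qed auto
  finally show ?thesis by (simp add: mult_ac)
qed

section \<open>Crossings and alternations\<close>

text \<open>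
  Positions \<open>x < y\<close> that are neighbours in the union of their two distinct blocks. These
  are the possible middle ends \<open>i'\<close> and \<open>j\<close> of a crossing \<open>i < i' < j < j'\<close>, since no
  further point of either block lies between them.
\<close>

definition alternations :: "nat set set \<Rightarrow> (nat \<times> nat) set" where
  "alternations P = (\<Union>B\<in>P. \<Union>C\<in>P - {B}. {(x, y)\<in>block_arcs (B \<union> C). x \<in> B \<and> y \<in> C})"

lemma block_arcs_right_unique: "(x, y) \<in> block_arcs U \<Longrightarrow> (x, z) \<in> block_arcs U \<Longrightarrow> y = z"
  by (auto simp: block_arcs_def) (meson linorder_less_linear)

lemma block_arcs_left_unique: "(x, z) \<in> block_arcs U \<Longrightarrow> (y, z) \<in> block_arcs U \<Longrightarrow> x = y"
  by (auto simp: block_arcs_def) (meson linorder_less_linear)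

context
  fixes A :: "nat set" and P :: "nat set set"
  assumes fin: "finite A" and P: "partition_on A P"
begin

lemma finite_blocks: "finite P"
  using fin P finite_elements by blast

lemma finite_block: "B \<in> P \<Longrightarrow> finite B"
  using partition_on_remove_block[OF P] fin finite_subset by blast

lemma block_nonempty: "B \<in> P \<Longrightarrow> B \<noteq> {}"
  using partition_on_remove_block[OF P] by blast

lemma balance_alternations:
  assumes BC: "B \<in> P" "C \<in> P" "B \<noteq> C"
  shows "balance B C + 2 * (real (card {(x, y)\<in>block_arcs (B \<union> C). x \<in> B \<and> y \<in> C})
      + real (card {(x, y)\<in>block_arcs (C \<union> B). x \<in> C \<and> y \<in> B})) = real (card B) + real (card C) - 1"
proof -
  let ?E = "block_arcs (B \<union> C)"
  have finBC: "finite B" "finite C" using BC finite_block by auto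
  have finE: "finite ?E" using finBC by (intro finite_block_arcs) auto
  have disj: "x \<in> B \<Longrightarrow> x \<notin> C" for x using BC same_block[OF P] by blast
  have count: "real (card {e\<in>?E. Q e}) = (\<Sum>e\<in>?E. if Q e then 1 else 0)" for Q
    using finE by (simp add: sum.If_cases Int_def)
  have 1: "{(x, y)\<in>?E. x \<in> B \<and> y \<in> C} = {e\<in>?E. fst e \<in> B \<and> snd e \<in> C}"
    "{(x, y)\<in>block_arcs (C \<union> B). x \<in> C \<and> y \<in> B} = {e\<in>?E. fst e \<in> C \<and> snd e \<in> B}"
    by (auto simp: Un_commute)
  have "balance B C + 2 * (real (card {(x, y)\<in>?E. x \<in> B \<and> y \<in> C})
      + real (card {(x, y)\<in>block_arcs (C \<union> B). x \<in> C \<and> y \<in> B})) = (\<Sum>e\<in>?E. 1)"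
    unfolding 1 count balance_def sum.distrib[symmetric] sum_distrib_left
    by (rule sum.cong) (auto simp: block_arcs_def dest: disj)
  also have "\<dots> = real (card ?E)" by simp
  also have "\<dots> = real (card (B \<union> C)) - 1"
    using card_block_arcs[of "B \<union> C"] finBC block_nonempty[OF BC(1)] by force
  also have "card (B \<union> C) = card B + card C"
    using finBC disj by (intro card_Un_disjoint) auto
  finally show ?thesis by simp
qed

lemma card_alternations_sum:
  "card (alternations P) = (\<Sum>B\<in>P. \<Sum>C\<in>P - {B}. card {(x, y)\<in>block_arcs (B \<union> C). x \<in> B \<and> y \<in> C})"
proof -
  have fin1: "finite {(x, y)\<in>block_arcs (B \<union> C). x \<in> B \<and> y \<in> C}" if "B \<in> P" "C \<in> P" for B C
    using that finite_block by (intro finite_subset[OF _ finite_block_arcs[of "B \<union> C"]]) auto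
  have "card (alternations P) = (\<Sum>B\<in>P. card (\<Union>C\<in>P - {B}. {(x, y)\<in>block_arcs (B \<union> C). x \<in> B \<and> y \<in> C}))"
    unfolding alternations_def
    by (rule card_UN_disjoint) (use fin1 finite_blocks in \<open>auto dest: same_block[OF P]\<close>)
  also have "\<dots> = (\<Sum>B\<in>P. \<Sum>C\<in>P - {B}. card {(x, y)\<in>block_arcs (B \<union> C). x \<in> B \<and> y \<in> C})"
    by (intro sum.cong refl card_UN_disjoint)
       (use fin1 finite_blocks in \<open>auto dest: same_block[OF P]\<close>)
  finally show ?thesis .
qed

text \<open>
  The pairs of neighbours in \<open>B \<union> C\<close> number \<open>card B + card C - 1\<close>, whatever the partition is.
  The balance is the number of those within a block minus the number of alternating ones, so up
  to the total balance about half of all these pairs alternate.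
\<close>

lemma card_alternations:
  "4 * real (card (alternations P)) =
     2 * real (card A) * (real (card P) - 1) - real (card P) * (real (card P) - 1) - total_balance P"
proof -
  let ?N = "real (card P)" and ?n = "real (card A)" and ?c = "\<lambda>B. real (card B)"
  define e where "e B C = real (card {(x, y)\<in>block_arcs (B \<union> C). x \<in> B \<and> y \<in> C})" for B C
  have alt: "real (card (alternations P)) = (\<Sum>B\<in>P. \<Sum>C\<in>P - {B}. e B C)"
    unfolding card_alternations_sum e_def by simp
  have alt': "real (card (alternations P)) = (\<Sum>B\<in>P. \<Sum>C\<in>P - {B}. e C B)"
    unfolding alt by (rule sum_swap_distinct[OF finite_blocks])
  have "total_balance P + 2 * ((\<Sum>B\<in>P. \<Sum>C\<in>P - {B}. e B C) + (\<Sum>B\<in>P. \<Sum>C\<in>P - {B}. e C B))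
      = (\<Sum>B\<in>P. \<Sum>C\<in>P - {B}. balance B C + 2 * (e B C + e C B))"
    by (simp add: total_balance_def sum.distrib sum_distrib_left)
  also have "\<dots> = (\<Sum>B\<in>P. \<Sum>C\<in>P - {B}. ?c B + ?c C - 1)"
    unfolding e_def by (intro sum.cong refl balance_alternations) auto
  also have "\<dots> = (\<Sum>B\<in>P. (?N - 2) * ?c B + ?n - (?N - 1))"
  proof (intro sum.cong refl)
    fix B assume B: "B \<in> P"
    have "real (card (P - {B})) = ?N - 1" using B finite_blocks card_Suc_Diff1[of P B] by simp
    moreover have "(\<Sum>C\<in>P - {B}. ?c C) = ?n - ?c B"
      using sum_card_blocks[OF fin P] B finite_blocks by (simp add: sum_diff1)
    moreover have "(\<Sum>C\<in>P - {B}. ?c B + ?c C - 1)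
        = real (card (P - {B})) * ?c B + (\<Sum>C\<in>P - {B}. ?c C) - real (card (P - {B}))"
      by (simp add: sum.distrib sum_subtractf)
    ultimately show "(\<Sum>C\<in>P - {B}. ?c B + ?c C - 1) = (?N - 2) * ?c B + ?n - (?N - 1)"
      by (simp only:) (simp add: algebra_simps)
  qed
  also have "\<dots> = (?N - 2) * ?n + ?N * ?n - ?N * (?N - 1)"
    by (simp add: sum.distrib sum_subtractf sum_distrib_left[symmetric] sum_card_blocks[OF fin P])
  also have "\<dots> = 2 * ?n * (?N - 1) - ?N * (?N - 1)" by (simp add: algebra_simps)
  finally show ?thesis unfolding alt[symmetric] alt'[symmetric] by simp
qed

lemma finite_arcs: "finite (arcs P)"
  unfolding arcs_def using finite_blocks finite_block finite_block_arcs by auto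

lemma finite_chords: "finite (chords P)"
  unfolding chords_def block_chords_def using finite_blocks finite_block finite_block_arcs by auto

lemma finite_crossings: "finite E \<Longrightarrow> finite (crossings E)"
  by (rule finite_subset[of _ "E \<times> E"]) (auto simp: crossings_def)

lemma arcsE:
  assumes "(i, j) \<in> arcs P"
  obtains B where "B \<in> P" "(i, j) \<in> block_arcs B" "i \<in> B" "j \<in> B"
  using assms by (auto simp: arcs_def block_arcs_def)

lemma arcs_right_unique: "(x, y) \<in> arcs P \<Longrightarrow> (x, z) \<in> arcs P \<Longrightarrow> y = z"
  by (metis arcsE same_block[OF P] block_arcs_right_unique)

lemma arcs_left_unique: "(x, z) \<in> arcs P \<Longrightarrow> (y, z) \<in> arcs P \<Longrightarrow> x = y"
  by (metis arcsE same_block[OF P] block_arcs_left_unique)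

text \<open>
  The two middle ends determine a crossing: the outer ends are the predecessor of \<open>j\<close> and the
  successor of \<open>i'\<close> in their blocks.
\<close>

lemma crossings_arcs_inner:
  "inj_on (\<lambda>((i, j), (i', j')). (i', j)) (crossings (arcs P))"
  "(\<lambda>((i, j), (i', j')). (i', j)) ` crossings (arcs P) \<subseteq> alternations P"
proof -
  show "inj_on (\<lambda>((i, j), (i', j')). (i', j)) (crossings (arcs P))"
    by (rule inj_onI) (auto simp: crossings_def dest: arcs_left_unique arcs_right_unique)
  show "(\<lambda>((i, j), (i', j')). (i', j)) ` crossings (arcs P) \<subseteq> alternations P"
  proof (clarsimp simp: crossings_def)
    fix i j i' j' assume *: "(i, j) \<in> arcs P" "(i', j') \<in> arcs P" "i < i'" "i' < j" "j < j'"
    obtain B where B: "B \<in> P" "(i, j) \<in> block_arcs B" using * by (auto elim: arcsE)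
    obtain C where C: "C \<in> P" "(i', j') \<in> block_arcs C" using * by (auto elim: arcsE)
    have "C \<noteq> B" using * B C by (auto simp: block_arcs_def)
    moreover have "(i', j) \<in> block_arcs (C \<union> B)" "i' \<in> C" "j \<in> B"
      using * B C by (auto simp: block_arcs_def)
    ultimately show "(i', j) \<in> alternations P" using B C by (auto simp: alternations_def)
  qed
qed

lemma finite_alternations: "finite (alternations P)"
  unfolding alternations_def using finite_blocks finite_block
  by (auto intro!: finite_subset[OF _ finite_block_arcs])

lemma cr_linear_le_alternations: "cr_linear P \<le> card (alternations P)"
  unfolding cr_linear_def using card_inj_on_le[OF crossings_arcs_inner finite_alternations] .

text \<open>
  An alternation \<open>(x, y)\<close> fails to come from a crossing only if \<open>x\<close> is the last point of its
  block or \<open>y\<close> the first point of its block. In either case \<open>(x, y)\<close> is determined by the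
  ordered pair of blocks, so each case accounts for at most \<open>(card P)\<^sup>2\<close> alternations.
\<close>

lemma alternations_le_cr_linear: "card (alternations P) \<le> cr_linear P + 2 * (card P)\<^sup>2"
proof -
  let ?in = "\<lambda>((i, j), (i', j')). (i', j)" and ?X = "crossings (arcs P)"
  let ?f = "\<lambda>(B, C). (Max B, SOME y. (Max B, y) \<in> block_arcs (B \<union> C))"
  let ?g = "\<lambda>(B, C). (SOME x. (x, Min C) \<in> block_arcs (B \<union> C), Min C)"
  have "alternations P \<subseteq> ?in ` ?X \<union> ?f ` (P \<times> P) \<union> ?g ` (P \<times> P)"
  proof (rule subsetI)
    fix e assume "e \<in> alternations P"
    then obtain x y B C where e: "e = (x, y)" and BC: "B \<in> P" "C \<in> P" "B \<noteq> C"
      and xy: "(x, y) \<in> block_arcs (B \<union> C)" "x \<in> B" "y \<in> C"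
      by (auto simp: alternations_def)
    have lt: "x < y" and gap: "\<And>z. z \<in> B \<union> C \<Longrightarrow> x < z \<Longrightarrow> z < y \<Longrightarrow> False"
      using xy by (auto simp: block_arcs_def)
    have disj: "x \<notin> C" "y \<notin> B" using xy BC same_block[OF P] by blast+
    consider "x = Max B" | "y = Min C" | "x < Max B" "Min C < y"
      using xy finite_block[OF BC(1)] finite_block[OF BC(2)]
      by (metis Max_ge Min_le order.strict_iff_order)
    then show "e \<in> ?in ` ?X \<union> ?f ` (P \<times> P) \<union> ?g ` (P \<times> P)"
    proof cases
      case 1
      have "(SOME y. (x, y) \<in> block_arcs (B \<union> C)) = y"
        using xy block_arcs_right_unique by (intro some_equality) blast+
      then have "e = ?f (B, C)" using 1 e by simp
      then show ?thesis using BC by blast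
    next
      case 2
      have "(SOME x. (x, y) \<in> block_arcs (B \<union> C)) = x"
        using xy block_arcs_left_unique by (intro some_equality) blast+
      then have "e = ?g (B, C)" using 2 e by simp
      then show ?thesis using BC by blast
    next
      case 3
      have fB: "finite B" "finite C" using BC finite_block by auto
      have "Max B \<in> B" "Min C \<in> C" using fB xy by (auto intro: Max_in Min_in)
      obtain j' where j': "(x, j') \<in> block_arcs B"
        using ex_block_arc_from[of B x "Max B"] fB xy 3 \<open>Max B \<in> B\<close> by blast
      obtain i where i: "(i, y) \<in> block_arcs C"
        using ex_block_arc_to[of C "Min C" y] fB xy 3 \<open>Min C \<in> C\<close> by blast
      have "y < j'"
      proof (rule ccontr)
        assume "\<not> y < j'"
        moreover have "j' \<noteq> y" using j' disj by (auto simp: block_arcs_def)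
        ultimately show False using gap[of j'] j' by (auto simp: block_arcs_def)
      qed
      moreover have "i < x"
      proof (rule ccontr)
        assume "\<not> i < x"
        moreover have "i \<noteq> x" using i disj by (auto simp: block_arcs_def)
        ultimately show False using gap[of i] i by (auto simp: block_arcs_def)
      qed
      ultimately have "((i, y), (x, j')) \<in> ?X"
        using i j' BC lt by (auto simp: crossings_def arcs_def)
      then have "?in ((i, y), (x, j')) \<in> ?in ` ?X" by (rule imageI)
      then show ?thesis using e by simp
    qed
  qed
  then have "card (alternations P) \<le> card (?in ` ?X \<union> ?f ` (P \<times> P) \<union> ?g ` (P \<times> P))"
    using finite_blocks finite_crossings[OF finite_arcs] by (intro card_mono) auto
  also have "\<dots> \<le> card (?in ` ?X) + card (?f ` (P \<times> P)) + card (?g ` (P \<times> P))"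
    by (intro order_trans[OF card_Un_le] add_mono card_Un_le order_refl)
  also have "\<dots> \<le> card ?X + card (P \<times> P) + card (P \<times> P)"
    using finite_blocks finite_crossings[OF finite_arcs] by (intro add_mono card_image_le) auto
  finally show ?thesis by (simp add: cr_linear_def card_cartesian_product power2_eq_square)
qed

text \<open>
  Of the arcs of one block at most one passes over \<open>p\<close>, and the block has at most one closing
  side.
\<close>

lemma card_chords_covering: "card {(a, b)\<in>chords P. a < p \<and> p < b} \<le> 2 * card P"
proof -
  let ?f = "\<lambda>B. SOME e. e \<in> block_arcs B \<and> fst e < p \<and> p < snd e"
  have "{(a, b)\<in>chords P. a < p \<and> p < b} \<subseteq> ?f ` P \<union> (\<lambda>B. (Min B, Max B)) ` P"
  proof clarify
    fix a b assume ab: "(a, b) \<in> chords P" "a < p" "p < b" "(a, b) \<notin> (\<lambda>B. (Min B, Max B)) ` P"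
    then obtain B where B: "B \<in> P" "(a, b) \<in> block_arcs B"
      by (auto simp: chords_def block_chords_def split: if_splits)
    have "?f B = (a, b)"
    proof (rule some_equality)
      fix e assume e: "e \<in> block_arcs B \<and> fst e < p \<and> p < snd e"
      obtain c d where cd: "e = (c, d)" by (cases e)
      have "\<not> a < c" "\<not> c < a" using e cd B ab by (auto simp: block_arcs_def)
      then have "a = c" by simp
      then show "e = (a, b)" using e cd B block_arcs_right_unique by auto
    qed (use B ab in auto)
    then show "(a, b) \<in> ?f ` P" using imageI[of B P ?f] B by simp
  qed
  then have "card {(a, b)\<in>chords P. a < p \<and> p < b} \<le> card (?f ` P \<union> (\<lambda>B. (Min B, Max B)) ` P)"
    using finite_blocks by (intro card_mono) auto
  also have "\<dots> \<le> card (?f ` P) + card ((\<lambda>B. (Min B, Max B)) ` P)" by (rule card_Un_le)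
  also have "\<dots> \<le> card P + card P" using finite_blocks by (intro add_mono card_image_le)
  finally show ?thesis by simp
qed

lemma cr_linear_le_circular: "cr_linear P \<le> cr_circular P"
  unfolding cr_linear_def cr_circular_def
  by (rule card_mono[OF finite_crossings[OF finite_chords]])
     (auto simp: crossings_def arcs_def chords_def block_chords_def)

text \<open>
  Every additional crossing involves a closing side, and a chord crossing that side passes over
  one of its two ends. There are at most \<open>card P\<close> closing sides.
\<close>

lemma cr_circular_le: "cr_circular P \<le> cr_linear P + 4 * (card P)\<^sup>2"
proof -
  define K where "K = (\<lambda>B. (Min B, Max B)) ` P"
  let ?cov = "\<lambda>p. {(a, b)\<in>chords P. a < p \<and> p < b}"
  let ?S = "Sigma K (\<lambda>e. ?cov (snd e))" and ?T = "Sigma K (\<lambda>e. ?cov (fst e))"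
  have K: "finite K" "card K \<le> card P"
    using finite_blocks card_image_le by (auto simp: K_def)
  have fincov: "finite (?cov p)" for p
    by (rule finite_subset[OF _ finite_chords]) auto
  have bound: "card (Sigma K (\<lambda>e. ?cov (h e))) \<le> 2 * (card P)\<^sup>2" for h
  proof -
    have "card (Sigma K (\<lambda>e. ?cov (h e))) = (\<Sum>e\<in>K. card (?cov (h e)))"
      by (rule card_SigmaI) (use K fincov in auto)
    also have "\<dots> \<le> (\<Sum>e\<in>K. 2 * card P)" by (intro sum_mono card_chords_covering)
    also have "\<dots> \<le> card P * (2 * card P)" using K by simp
    finally show ?thesis by (simp add: power2_eq_square)
  qed
  have chords: "e \<in> arcs P \<or> e \<in> K" if "e \<in> chords P" for e
    using that by (auto simp: chords_def arcs_def block_chords_def K_def split: if_splits)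
  have "crossings (chords P) \<subseteq> crossings (arcs P) \<union> ?S \<union> prod.swap ` ?T"
  proof
    fix c assume "c \<in> crossings (chords P)"
    then obtain i j i' j' where c: "c = ((i, j), (i', j'))"
      and e: "(i, j) \<in> chords P" "(i', j') \<in> chords P" and o: "i < i'" "i' < j" "j < j'"
      by (auto simp: crossings_def)
    consider "(i, j) \<in> arcs P" "(i', j') \<in> arcs P" | "(i, j) \<in> K" | "(i', j') \<in> K"
      using chords[OF e(1)] chords[OF e(2)] by blast
    then show "c \<in> crossings (arcs P) \<union> ?S \<union> prod.swap ` ?T"
    proof cases
      case 1 then show ?thesis using c o by (auto simp: crossings_def)
    next
      case 2 then show ?thesis using c o e by auto
    next
      case 3
      then have "((i', j'), (i, j)) \<in> ?T" using o e by auto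
      then have "prod.swap ((i', j'), (i, j)) \<in> prod.swap ` ?T" by (rule imageI)
      then show ?thesis using c by simp
    qed
  qed
  then have "cr_circular P \<le> card (crossings (arcs P) \<union> ?S \<union> prod.swap ` ?T)"
    unfolding cr_circular_def using K fincov finite_crossings[OF finite_arcs]
    by (intro card_mono) auto
  also have "\<dots> \<le> card (crossings (arcs P)) + card ?S + card (prod.swap ` ?T)"
    by (intro order_trans[OF card_Un_le] add_mono card_Un_le order_refl)
  also have "\<dots> \<le> cr_linear P + 2 * (card P)\<^sup>2 + 2 * (card P)\<^sup>2"
    using bound[of snd] bound[of fst] card_image_le[of ?T prod.swap] K fincov
    unfolding cr_linear_def by (intro add_mono) (auto simp: card_image)
  finally show ?thesis by simp
qed

lemma crossings_approx:
  assumes F: "F = real (cr_linear P) \<or> F = real (cr_circular P)"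
  shows "\<bar>F - real (card A) * real (card P) / 2\<bar>
         \<le> real (card A) / 2 + 5 * (real (card P))\<^sup>2 + \<bar>total_balance P\<bar> / 4"
proof -
  let ?N = "real (card P)" and ?n = "real (card A)" and ?a = "real (card (alternations P))"
  have "?N * (?N - 1) \<ge> 0"
    by (cases "card P = 0") (auto simp: Suc_le_eq intro!: mult_nonneg_nonneg)
  then have N: "0 \<le> ?N * (?N - 1)" "?N * (?N - 1) \<le> ?N\<^sup>2" by (auto simp: power2_eq_square algebra_simps)
  have nat: "card (alternations P) \<le> cr_linear P + 2 * (card P)\<^sup>2" "cr_linear P \<le> card (alternations P)"
    "cr_linear P \<le> cr_circular P" "cr_circular P \<le> cr_linear P + 4 * (card P)\<^sup>2"
    using alternations_le_cr_linear cr_linear_le_alternations cr_linear_le_circular cr_circular_le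
    by blast+
  have "?a - 2 * ?N\<^sup>2 \<le> real (cr_linear P)" "real (cr_linear P) \<le> ?a"
    "real (cr_linear P) \<le> real (cr_circular P)" "real (cr_circular P) \<le> real (cr_linear P) + 4 * ?N\<^sup>2"
    using nat[THEN of_nat_mono[where 'a = real]] by simp_all
  then have F: "?a - 2 * ?N\<^sup>2 \<le> F" "F \<le> ?a + 4 * ?N\<^sup>2" using F by auto
  have "2 * ?n * (?N - 1) = 2 * (?n * ?N) - 2 * ?n" by (simp add: algebra_simps)
  then have "4 * ?a = 2 * (?n * ?N) - 2 * ?n - ?N * (?N - 1) - total_balance P"
    using card_alternations by simp
  moreover have "0 \<le> ?n" "0 \<le> ?N\<^sup>2" by simp_all
  ultimately show ?thesis using F N by linarith
qed

end

section \<open>Concentration\<close>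

text \<open>
  If \<open>F\<close> is close to a deterministic \<open>c\<close> in mean, then so is its mean, and Markov's
  inequality for \<open>F - E F\<close> finishes the argument.
\<close>

lemma converges_in_prob_ratio_mean:
  fixes p :: "nat \<Rightarrow> 'a pmf" and F :: "nat \<Rightarrow> 'a \<Rightarrow> real"
  assumes fin: "\<And>n. finite (set_pmf (p n))"
    and c: "eventually (\<lambda>n. c n > 0) sequentially"
    and lim: "(\<lambda>n. measure_pmf.expectation (p n) (\<lambda>x. \<bar>F n x - c n\<bar>) / c n) \<longlonglongrightarrow> 0"
  shows "converges_in_prob (\<lambda>n. measure_pmf (p n))
           (\<lambda>n x. F n x / measure_pmf.expectation (p n) (F n)) 1"
  unfolding converges_in_prob_def
proof (intro allI impI)
  fix \<epsilon> :: real assume eps: "\<epsilon> > 0"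
  define d where "d n = measure_pmf.expectation (p n) (\<lambda>x. \<bar>F n x - c n\<bar>) / c n" for n
  let ?m = "\<lambda>n. measure_pmf.expectation (p n) (F n)"
  let ?Pr = "\<lambda>n. measure (measure_pmf (p n)) {x \<in> space (measure_pmf (p n)). \<bar>F n x / ?m n - 1\<bar> > \<epsilon>}"
  have int: "integrable (measure_pmf (p n)) f" for f :: "'a \<Rightarrow> real" and n
    by (rule integrable_measure_pmf_finite[OF fin])
  have "eventually (\<lambda>n. d n < 1 / 2) sequentially"
    using lim unfolding d_def[symmetric] by (rule order_tendstoD) simp
  then have "eventually (\<lambda>n. norm (?Pr n) \<le> 4 / \<epsilon> * d n) sequentially"
    using c
  proof eventually_elim
    case (elim n)
    let ?E = "measure_pmf.expectation (p n)"
    have dc: "?E (\<lambda>x. \<bar>F n x - c n\<bar>) = d n * c n" using elim by (simp add: d_def)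
    have "\<bar>?m n - c n\<bar> = \<bar>?E (\<lambda>x. F n x - c n)\<bar>" using int by simp
    also have "\<dots> \<le> ?E (\<lambda>x. \<bar>F n x - c n\<bar>)" by (rule integral_abs_bound)
    finally have mc: "\<bar>?m n - c n\<bar> \<le> d n * c n" using dc by simp
    have "d n * c n \<le> 1 / 2 * c n" using elim by (intro mult_right_mono) auto
    with mc have m: "?m n \<ge> c n / 2" by linarith
    then have m0: "?m n > 0" using elim by linarith
    have "?Pr n \<le> measure (measure_pmf (p n)) {x \<in> space (measure_pmf (p n)). \<epsilon> * ?m n \<le> \<bar>F n x - ?m n\<bar>}"
    proof (intro measure_pmf.finite_measure_mono subsetI)
      fix x assume "x \<in> {x \<in> space (measure_pmf (p n)). \<bar>F n x / ?m n - 1\<bar> > \<epsilon>}"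
      then have "\<epsilon> * ?m n < \<bar>F n x / ?m n - 1\<bar> * ?m n"
        using m0 by (intro mult_strict_right_mono) auto
      also have "\<dots> = \<bar>(F n x / ?m n - 1) * ?m n\<bar>" using m0 by (simp add: abs_mult)
      also have "(F n x / ?m n - 1) * ?m n = F n x - ?m n" using m0 by (simp add: left_diff_distrib)
      finally show "x \<in> {x \<in> space (measure_pmf (p n)). \<epsilon> * ?m n \<le> \<bar>F n x - ?m n\<bar>}" by simp
    qed simp
    also have "\<dots> \<le> ?E (\<lambda>x. \<bar>F n x - ?m n\<bar>) / (\<epsilon> * ?m n)"
      by (rule integral_Markov_inequality_measure[where A = "{}"]) (use int eps m0 in auto)
    also have "\<dots> \<le> (2 * (d n * c n)) / (\<epsilon> * (c n / 2))"
    proof (rule frac_le)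
      have "?E (\<lambda>x. \<bar>F n x - ?m n\<bar>) \<le> ?E (\<lambda>x. \<bar>F n x - c n\<bar> + \<bar>?m n - c n\<bar>)"
        by (rule integral_mono[OF int int]) linarith
      also have "\<dots> = d n * c n + \<bar>?m n - c n\<bar>" using int dc by simp
      finally show "?E (\<lambda>x. \<bar>F n x - ?m n\<bar>) \<le> 2 * (d n * c n)" using mc by linarith
      show "0 \<le> 2 * (d n * c n)" using mc by linarith
      show "0 < \<epsilon> * (c n / 2)" using eps elim by simp
      show "\<epsilon> * (c n / 2) \<le> \<epsilon> * ?m n" using eps m by (intro mult_left_mono) auto
    qed
    also have "\<dots> = 4 / \<epsilon> * d n" using elim eps by (simp add: field_simps)
    finally show ?case by simp
  qed
  moreover have "(\<lambda>n. 4 / \<epsilon> * d n) \<longlonglongrightarrow> 0"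
    using tendsto_mult_right_zero[OF lim, of "4 / \<epsilon>"] by (simp add: d_def)
  ultimately show "?Pr \<longlonglongrightarrow> 0" by (rule Lim_null_comparison)
qed

lemma abs_le_square: "t > 0 \<Longrightarrow> \<bar>x\<bar> \<le> t / 2 + x\<^sup>2 / (2 * t)" for x t :: real
proof -
  assume t: "t > 0"
  have "2 * t * \<bar>x\<bar> \<le> t\<^sup>2 + x\<^sup>2" using sum_squares_bound[of t "\<bar>x\<bar>"] by simp
  then show ?thesis using t by (simp add: field_simps power2_eq_square)
qed

text \<open>
  A bound in mean square gives a bound in mean, in a form with a free parameter \<open>t\<close>, which is
  to be chosen of the order of the root mean square.
\<close>

lemma sum_abs_le_of_square:
  fixes f :: "'a \<Rightarrow> real"
  assumes "t > 0" "(\<Sum>x\<in>S. (f x)\<^sup>2) \<le> b"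
  shows "(\<Sum>x\<in>S. \<bar>f x\<bar>) \<le> t / 2 * real (card S) + b / (2 * t)"
proof -
  have "(\<Sum>x\<in>S. \<bar>f x\<bar>) \<le> (\<Sum>x\<in>S. t / 2 + (f x)\<^sup>2 / (2 * t))"
    by (intro sum_mono abs_le_square assms)
  also have "\<dots> = t / 2 * real (card S) + (\<Sum>x\<in>S. (f x)\<^sup>2) / (2 * t)"
    by (simp add: sum.distrib sum_divide_distrib)
  also have "\<dots> \<le> t / 2 * real (card S) + b / (2 * t)"
    using assms by (intro add_left_mono divide_right_mono) auto
  finally show ?thesis .
qed

lemma sum_card_square_le:
  "(\<Sum>P\<in>set_partitions n. (real (card P) + 1)\<^sup>2) \<le> bell_ratio n * (bell_ratio n + 1) * bell n"
proof -
  have "(\<Sum>P\<in>set_partitions n. (real (card P) + 1)\<^sup>2) \<le> bell (Suc (Suc n))"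
    unfolding bell_Suc_Suc by (intro sum_mono) simp
  also have "\<dots> = bell_ratio (Suc n) * (bell_ratio n * bell n)" by (simp add: bell_Suc_eq)
  also have "\<dots> \<le> (bell_ratio n + 1) * (bell_ratio n * bell n)"
    using bell_ratio_Suc_le[of n] bell_ratio_ge_1[of n] bell_pos[of n] by (intro mult_right_mono) auto
  finally show ?thesis by (simp add: mult_ac)
qed

text \<open>
  Writing \<open>r\<^sub>n\<close> for the ratio of Bell numbers, the variance of \<open>card P\<close> equals
  \<open>r\<^sub>n r\<^sub>n\<^sub>+\<^sub>1 - 1 - r\<^sub>n\<^sup>2\<close>, and the next ratio exceeds \<open>r\<^sub>n\<close> by at most \<open>1\<close>.
\<close>

lemma sum_card_variance:
  "(\<Sum>P\<in>set_partitions n. (real (card P) + 1 - bell_ratio n)\<^sup>2) \<le> bell_ratio n * bell n"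
proof -
  let ?r = "bell_ratio n" and ?S = "set_partitions n"
  have "(\<Sum>P\<in>?S. (real (card P) + 1 - ?r)\<^sup>2)
      = (\<Sum>P\<in>?S. (real (card P) + 1)\<^sup>2 - 2 * ?r * (real (card P) + 1) + ?r\<^sup>2)"
    by (intro sum.cong refl) (simp add: power2_diff)
  also have "\<dots> = (\<Sum>P\<in>?S. (real (card P) + 1)\<^sup>2) - 2 * ?r * (\<Sum>P\<in>?S. real (card P) + 1) + ?r\<^sup>2 * bell n"
    by (simp add: sum.distrib sum_subtractf sum_distrib_left[symmetric] bell_def)
  also have "(\<Sum>P\<in>?S. real (card P) + 1) = ?r * bell n"
    unfolding bell_Suc[symmetric] by (rule bell_Suc_eq)
  also have "(\<Sum>P\<in>?S. (real (card P) + 1)\<^sup>2) - 2 * ?r * (?r * bell n) + ?r\<^sup>2 * bell n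
      \<le> ?r * (?r + 1) * bell n - 2 * ?r * (?r * bell n) + ?r\<^sup>2 * bell n"
    using sum_card_square_le[of n] by simp
  also have "\<dots> = ?r * bell n" by (simp add: algebra_simps power2_eq_square)
  finally show ?thesis .
qed

text \<open>
  Here \<open>n * bell_ratio n / 2\<close> is the asymptotic value of the mean. The number of blocks and the
  total balance both enter through their second moments, of orders \<open>bell_ratio n\<close> and
  \<open>n\<^sup>2 bell_ratio n\<close>; this produces the term with the square root. The last term bounds the
  error of order \<open>(card P)\<^sup>2\<close>.
\<close>

lemma crossings_mean_deviation:
  assumes n: "n > 0"
    and F: "\<And>P. F P = real (cr_linear P) \<or> F P = real (cr_circular P)"
  shows "measure_pmf.expectation (uniform_partition n) (\<lambda>P. \<bar>F P - real n * bell_ratio n / 2\<bar>)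
         \<le> 5 * real n * sqrt (bell_ratio n) + real n + 5 * bell_ratio n * (bell_ratio n + 1)"
proof -
  let ?r = "bell_ratio n" and ?S = "set_partitions n" and ?N = "\<lambda>P. real (card P)"
  let ?s = "sqrt (bell_ratio n)" and ?n = "real n"
  have r: "?r \<ge> 1" by (rule bell_ratio_ge_1)
  then have s: "?s > 0" "?s * ?s = ?r" by simp_all
  have b: "bell n > 0" by (rule bell_pos)
  have pw: "\<bar>F P - ?n * ?r / 2\<bar> \<le> ?n / 2 * \<bar>?N P + 1 - ?r\<bar> + ?n + 5 * (?N P + 1)\<^sup>2 + \<bar>total_balance P\<bar> / 4"
    if "P \<in> ?S" for P
  proof -
    have P: "partition_on {1..n} P" using that by (simp add: set_partitions_def)
    have "\<bar>F P - ?n * ?N P / 2\<bar> \<le> ?n / 2 + 5 * (?N P)\<^sup>2 + \<bar>total_balance P\<bar> / 4"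
      using crossings_approx[OF _ P, of "F P"] F[of P] by simp
    moreover have "?n * ?N P / 2 - ?n * ?r / 2 = ?n / 2 * (?N P + 1 - ?r) - ?n / 2"
      by (simp add: field_simps)
    moreover have "\<bar>?n / 2 * (?N P + 1 - ?r)\<bar> = ?n / 2 * \<bar>?N P + 1 - ?r\<bar>" by (simp add: abs_mult)
    moreover have "(?N P)\<^sup>2 \<le> (?N P + 1)\<^sup>2" by (intro power_mono) auto
    moreover have "?n \<ge> 0" by simp
    ultimately show ?thesis by linarith
  qed
  have 1: "(\<Sum>P\<in>?S. \<bar>?N P + 1 - ?r\<bar>) \<le> ?s * bell n"
  proof -
    have "(\<Sum>P\<in>?S. \<bar>?N P + 1 - ?r\<bar>) \<le> ?s / 2 * real (card ?S) + (?r * bell n) / (2 * ?s)"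
      by (rule sum_abs_le_of_square[OF s(1) sum_card_variance])
    also have "(?r * bell n) / (2 * ?s) = ?s / 2 * bell n"
      using s by (simp add: field_simps)
    finally show ?thesis by (simp add: bell_def)
  qed
  have 2: "(\<Sum>P\<in>?S. \<bar>total_balance P\<bar>) \<le> 29 / 2 * ?n * ?s * bell n"
  proof -
    have "?n * ?s > 0" using n s by simp
    then have "(\<Sum>P\<in>?S. \<bar>total_balance P\<bar>)
        \<le> (?n * ?s) / 2 * real (card ?S) + (28 * ?n\<^sup>2 * bell (Suc n)) / (2 * (?n * ?s))"
      by (rule sum_abs_le_of_square[OF _ sum_total_balance_square])
    also have "28 * ?n\<^sup>2 * bell (Suc n) = (28 * ?n * ?s * bell n) * (?n * ?s)"
    proof -
      have "bell (Suc n) = ?s * ?s * bell n" by (simp only: bell_Suc_eq s(2))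
      then show ?thesis by (simp only: power2_eq_square mult_ac)
    qed
    also have "(28 * ?n * ?s * bell n) * (?n * ?s) / (2 * (?n * ?s)) = 14 * ?n * ?s * bell n"
      using \<open>?n * ?s > 0\<close> by simp
    finally show ?thesis by (simp add: bell_def algebra_simps)
  qed
  have "(\<Sum>P\<in>?S. \<bar>F P - ?n * ?r / 2\<bar>)
      \<le> (\<Sum>P\<in>?S. ?n / 2 * \<bar>?N P + 1 - ?r\<bar> + ?n + 5 * (?N P + 1)\<^sup>2 + 1 / 4 * \<bar>total_balance P\<bar>)"
    using pw by (intro sum_mono) simp
  also have "\<dots> = ?n / 2 * (\<Sum>P\<in>?S. \<bar>?N P + 1 - ?r\<bar>) + ?n * bell n
      + 5 * (\<Sum>P\<in>?S. (?N P + 1)\<^sup>2) + 1 / 4 * (\<Sum>P\<in>?S. \<bar>total_balance P\<bar>)"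
    by (simp only: sum.distrib sum_distrib_left sum_constant bell_def mult.commute)
  also have "\<dots> \<le> ?n / 2 * (?s * bell n) + ?n * bell n
      + 5 * (?r * (?r + 1) * bell n) + 1 / 4 * (29 / 2 * ?n * ?s * bell n)"
    using 1 2 sum_card_square_le[of n] by (intro add_mono mult_left_mono) auto
  also have "\<dots> = (33 / 8 * ?n * ?s + ?n + 5 * ?r * (?r + 1)) * bell n" by (simp add: algebra_simps)
  also have "\<dots> \<le> (5 * ?n * ?s + ?n + 5 * ?r * (?r + 1)) * bell n"
    using b s by (intro mult_right_mono add_mono) auto
  finally have "(\<Sum>P\<in>?S. \<bar>F P - ?n * ?r / 2\<bar>) / bell n \<le> 5 * ?n * ?s + ?n + 5 * ?r * (?r + 1)"
    using b by (simp add: divide_le_eq)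
  then show ?thesis
    by (simp add: uniform_partition_def integral_pmf_of_set bell_def)
qed

text \<open>
  Divided by \<open>n * bell_ratio n / 2\<close>, the three error terms vanish because \<open>bell_ratio n\<close> tends to
  infinity but more slowly than \<open>n\<close>.
\<close>

lemma crossings_concentrated:
  assumes F: "\<And>n P. F n P = real (cr_linear P) \<or> F n P = real (cr_circular P)"
  shows "converges_in_prob (\<lambda>n. measure_pmf (uniform_partition n))
           (\<lambda>n P. F n P / measure_pmf.expectation (uniform_partition n) (F n)) 1"
proof (rule converges_in_prob_ratio_mean[where c = "\<lambda>n. real n * bell_ratio n / 2"])
  show "finite (set_pmf (uniform_partition n))" for n by (simp add: uniform_partition_def)
  have pos: "real n * bell_ratio n / 2 > 0" if "n > 0" for n
    using that bell_ratio_ge_1[of n] by simp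
  then show "eventually (\<lambda>n. real n * bell_ratio n / 2 > 0) sequentially"
    by (auto simp: eventually_sequentially intro: exI[of _ 1])
  let ?d = "\<lambda>n. measure_pmf.expectation (uniform_partition n) (\<lambda>P. \<bar>F n P - real n * bell_ratio n / 2\<bar>)
      / (real n * bell_ratio n / 2)"
  let ?b = "\<lambda>n. 10 * inverse (sqrt (bell_ratio n)) + 2 * inverse (bell_ratio n)
      + 10 * (bell_ratio n / real n + 1 / real n)"
  have "(\<lambda>n. inverse (bell_ratio n)) \<longlonglongrightarrow> 0"
    by (rule tendsto_inverse_0_at_top[OF bell_ratio_at_top])
  moreover have "(\<lambda>n. inverse (sqrt (bell_ratio n))) \<longlonglongrightarrow> 0"
    by (intro tendsto_inverse_0_at_top filterlim_compose[OF sqrt_at_top bell_ratio_at_top])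
  ultimately have "?b \<longlonglongrightarrow> 10 * 0 + 2 * 0 + 10 * (0 + 0)"
    using bell_ratio_sublinear lim_1_over_n by (intro tendsto_intros) auto
  then have "?b \<longlonglongrightarrow> 0" by simp
  moreover have "eventually (\<lambda>n. norm (?d n) \<le> ?b n) sequentially"
    using eventually_gt_at_top[of 0]
  proof eventually_elim
    case (elim n)
    let ?r = "bell_ratio n"
    have r: "?r \<ge> 1" by (rule bell_ratio_ge_1)
    have "?d n \<ge> 0" using pos[OF elim] by (intro divide_nonneg_pos) auto
    moreover have "?d n \<le> (5 * real n * sqrt ?r + real n + 5 * ?r * (?r + 1)) / (real n * ?r / 2)"
      using crossings_mean_deviation[of n "F n"] F elim pos[OF elim] by (intro divide_right_mono) auto
    moreover have "\<dots> = 10 * (sqrt ?r / ?r) + 2 * inverse ?r + 10 * (?r / real n + 1 / real n)"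
      using elim r by (simp add: field_simps)
    moreover have "sqrt ?r / ?r = inverse (sqrt ?r)"
      using r by (simp add: sqrt_divide_self_eq)
    ultimately show ?case by simp
  qed
  ultimately show "?d \<longlonglongrightarrow> 0" by (rule Lim_null_comparison[rotated])
qed

theorem corollary1p11:
  shows "converges_in_prob (\<lambda>n. measure_pmf (uniform_partition n))
           (\<lambda>n P. X n P / measure_pmf.expectation (uniform_partition n) (X n)) 1
       \<and> converges_in_prob (\<lambda>n. measure_pmf (uniform_partition n))
           (\<lambda>n P. Y n P / measure_pmf.expectation (uniform_partition n) (Y n)) 1"
  by (intro conjI crossings_concentrated) (simp_all add: X_def Y_def)

end
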